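(* Let $X \subset \mathbb{R}^n$ be a compact set, and suppose that either the magnitude dimension $\mathrm{dim}_{\mathrm{Mag}} X$ or the Minkowski dimension $\mathrm{dim}_{\mathrm{Mink}} X$ exists. Then $$\mathrm{dim}_{\mathrm{Mag}} X = \mathrm{dim}_{\mathrm{PH}}^{0} X,$$ where $\mathrm{dim}_{\mathrm{PH}}^{0} X$ is the (degree-$0$) persistent homology dimension of $X$.
   Context: The theorem is stated under the general assumption that all the notions of dimension involved exist. **Magnitude.** For a finite metric space $(F,d)$ with points $x_1,\dots,x_k$, the similarity matrix is $\zeta_{ij} = e^{-d(x_i,x_j)}$. If $\zeta$ is invertible, the magnitude is $\mathrm{Mag}(F) = \sum_{i,j} (\zeta^{-1})_{ij}$. For finite subsets of $\mathbb{R}^n$, $\zeta$ is symmetric positive definite, so the magnitude exists. For an infinite compact subset of $\mathbb{R}^n$, $\mathrm{Mag}$ denotes its magnitude in the sense of the general theory of magnitude of metric spaces (Leinster, Meckes), which is known to exist for such sets. For $t>0$, $tX$ denotes the metric space with the same points as $X$ and metric $d_t(x,y) = t\,d(x,y)$. **Magnitude dimension.** $\mathrm{dim}_{\mathrm{Mag}} X = \lim_{t\to\infty} \frac{\log \mathrm{Mag}(tX)}{\log t}$, when this limit exists. **Minkowski dimension.** For a bounded metric space $X$, let $N_\delta(X)$ be the maximal number of disjoint closed $\delta$-balls with centers in $X$. The (upper box/) Minkowski dimension is $\mathrm{dim}_{\mathrm{Mink}} X = \limsup_{\delta\to 0} \frac{\log N_\delta(X)}{\log(1/\delta)}$. **Persistent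 homology dimension.** For a bounded metric space $X$, $$\mathrm{dim}_{\mathrm{PH}}^{0} X = \inf\{\alpha>0 : \exists\, C>0 \text{ such that } E_\alpha(W) < C \text{ for every finite } W\subset X\},$$ where $E_\alpha(W) = \sum_{(b,d)\in PH^0(\mathrm{Rips}(W))} (d-b)^\alpha$ is the $\alpha$-lifetime sum, and $b$ and $d$ are the birth and death values in the degree-$0$ persistent homology $PH^0$ (which measures connected components) of the Vietoris–Rips filtration $\mathrm{Rips}(W)$ of $W$. *)

theory Defs
  imports
    "HOL-Analysis.Analysis"
    "HOL-Library.Poly_Mapping"
    "HOL-Library.Z2"
    "Jordan_Normal_Form.Matrix"
begin

section \<open>Magnitude\<close>

text \<open>
  The metric is an explicit argument \<open>d\<close>, so that the rescaled space \<open>tX\<close> is the set \<open>X\<close>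
  together with \<open>\<lambda>x y. t * dist x y\<close>.
\<close>

definition similarity_matrix :: "('a \<Rightarrow> 'a \<Rightarrow> real) \<Rightarrow> 'a list \<Rightarrow> real mat" where
  "similarity_matrix d xs = Matrix.mat (length xs) (length xs) (\<lambda>(i, j). exp (- d (xs ! i) (xs ! j)))"

text \<open>
  \<open>has_magnitude d F m\<close>: the similarity matrix of the finite space \<open>(F, d)\<close> is invertible and the
  entries of its inverse add up to \<open>m\<close>. Neither invertibility nor \<open>m\<close> depends on the enumeration
  \<open>xs\<close> of \<open>F\<close>.
\<close>

definition has_magnitude :: "('a \<Rightarrow> 'a \<Rightarrow> real) \<Rightarrow> 'a set \<Rightarrow> real \<Rightarrow> bool" where
  "has_magnitude d F m \<longleftrightarrow>
     (\<exists>xs B. distinct xs \<and> set xs = F \<and>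
        inverts_mat (similarity_matrix d xs) B \<and> inverts_mat B (similarity_matrix d xs) \<and>
        m = (\<Sum>i<length xs. \<Sum>j<length xs. B $$ (i, j)))"

definition finite_magnitude :: "('a \<Rightarrow> 'a \<Rightarrow> real) \<Rightarrow> 'a set \<Rightarrow> real" where
  "finite_magnitude d F = (THE m. has_magnitude d F m)"

text \<open>
  For an infinite compact positive definite space (such as a compact subset of Euclidean space) the
  magnitude is, following Leinster and Meckes, the supremum of the magnitudes of its finite subspaces.
\<close>

definition magnitude :: "('a \<Rightarrow> 'a \<Rightarrow> real) \<Rightarrow> 'a set \<Rightarrow> real" where
  "magnitude d X =
     (if finite X then finite_magnitude d X
      else (SUP F\<in>{F. finite F \<and> F \<subseteq> X}. finite_magnitude d F))"

definition magnitude_growth :: "'a::metric_space set \<Rightarrow> real \<Rightarrow> real" where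
  "magnitude_growth X t = ln (magnitude (\<lambda>x y. t * dist x y) X) / ln t"

definition magnitude_dimension_exists :: "'a::metric_space set \<Rightarrow> bool" where
  "magnitude_dimension_exists X \<longleftrightarrow> (\<exists>s. (magnitude_growth X \<longlongrightarrow> s) at_top)"

definition magnitude_dimension :: "'a::metric_space set \<Rightarrow> real" where
  "magnitude_dimension X = Lim at_top (magnitude_growth X)"


section \<open>Minkowski dimension\<close>

text \<open>
  Balls are taken in the metric space \<open>X\<close>, i.e. they are intersected with \<open>X\<close>. The supremum is a
  maximum whenever \<open>X\<close> is totally bounded and \<open>\<delta> > 0\<close>.
\<close>

definition packing_number :: "real \<Rightarrow> 'a::metric_space set \<Rightarrow> nat" where
  "packing_number \<delta> X =
     Sup {card P | P. finite P \<and> P \<subseteq> X \<and> disjoint_family_on (\<lambda>x. cball x \<delta> \<inter> X) P}"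

definition packing_growth :: "'a::metric_space set \<Rightarrow> real \<Rightarrow> ereal" where
  "packing_growth X \<delta> = ereal (ln (real (packing_number \<delta> X)) / ln (1 / \<delta>))"

definition minkowski_dimension :: "'a::metric_space set \<Rightarrow> ereal" where
  "minkowski_dimension X = Limsup (at_right 0) (packing_growth X)"

text \<open>
  The upper limit always makes sense; the Minkowski dimension is said to exist if it is a limit,
  i.e. if the upper and the lower box dimension agree.
\<close>

definition minkowski_dimension_exists :: "'a::metric_space set \<Rightarrow> bool" where
  "minkowski_dimension_exists X \<longleftrightarrow> (packing_growth X \<longlongrightarrow> minkowski_dimension X) (at_right 0)"


section \<open>Persistent homology of the Vietoris-Rips filtration\<close>

definition rips :: "'a::metric_space set \<Rightarrow> real \<Rightarrow> 'a set set" where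
  "rips W r = {\<sigma>. \<sigma> \<noteq> {} \<and> finite \<sigma> \<and> \<sigma> \<subseteq> W \<and> (\<forall>x\<in>\<sigma>. \<forall>y\<in>\<sigma>. dist x y \<le> r)}"

text \<open>
  Simplicial homology has coefficients in the field with two elements, so no orientations are needed.
  It is not reduced: the boundary of a vertex is \<open>0\<close>.
\<close>

definition chain_scale :: "bit \<Rightarrow> ('a set \<Rightarrow>\<^sub>0 bit) \<Rightarrow> ('a set \<Rightarrow>\<^sub>0 bit)" where
  "chain_scale a c = Poly_Mapping.map ((*) a) c"

lemma vector_space_chain_scale: "vector_space chain_scale"
proof -
  have l: "Poly_Mapping.lookup (chain_scale a c) x = a * Poly_Mapping.lookup c x" for a :: bit and c :: "'b set \<Rightarrow>\<^sub>0 bit" and x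
    unfolding chain_scale_def by transfer (auto simp: when_def)
  show ?thesis
    by unfold_locales (auto intro!: poly_mapping_eqI simp: l lookup_add algebra_simps)
qed

definition chains :: "nat \<Rightarrow> 'a set set \<Rightarrow> ('a set \<Rightarrow>\<^sub>0 bit) set" where
  "chains k K = {c. \<forall>\<sigma>\<in>Poly_Mapping.keys c. \<sigma> \<in> K \<and> card \<sigma> = Suc k}"

definition simplex_boundary :: "'a set \<Rightarrow> ('a set \<Rightarrow>\<^sub>0 bit)" where
  "simplex_boundary \<sigma> = (if card \<sigma> \<le> 1 then 0 else (\<Sum>v\<in>\<sigma>. Poly_Mapping.single (\<sigma> - {v}) 1))"

definition boundary :: "('a set \<Rightarrow>\<^sub>0 bit) \<Rightarrow> ('a set \<Rightarrow>\<^sub>0 bit)" where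
  "boundary c = (\<Sum>\<sigma>\<in>Poly_Mapping.keys c. chain_scale (Poly_Mapping.lookup c \<sigma>) (simplex_boundary \<sigma>))"

definition cycles :: "nat \<Rightarrow> 'a set set \<Rightarrow> ('a set \<Rightarrow>\<^sub>0 bit) set" where
  "cycles k K = {c \<in> chains k K. boundary c = 0}"

definition boundaries :: "nat \<Rightarrow> 'a set set \<Rightarrow> ('a set \<Rightarrow>\<^sub>0 bit) set" where
  "boundaries k K = boundary ` chains (Suc k) K"

text \<open>
  For \<open>s \<le> t\<close> this is the rank of \<open>H\<^sub>k (K s) \<rightarrow> H\<^sub>k (K t)\<close>, i.e. the dimension of
  \<open>Z\<^sub>k (K s) / (Z\<^sub>k (K s) \<inter> B\<^sub>k (K t))\<close>.
\<close>

definition persistent_betti :: "nat \<Rightarrow> (real \<Rightarrow> 'a set set) \<Rightarrow> real \<Rightarrow> real \<Rightarrow> nat" where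
  "persistent_betti k K s t =
     vector_space.dim chain_scale (cycles k (K s)) -
     vector_space.dim chain_scale (cycles k (K s) \<inter> boundaries k (K t))"

text \<open>
  The number of classes of the degree \<open>k\<close> persistent homology of the filtration \<open>K\<close> with birth
  value \<open>b\<close> and finite death value \<open>d > b\<close>: the classes that are born at \<open>b\<close> and alive just before
  \<open>d\<close>, minus those born at \<open>b\<close> and still alive at \<open>d\<close>. For the Rips filtration of a finite
  space the expression is constant for small \<open>\<epsilon> > 0\<close>.
\<close>

definition persistence_multiplicity ::
    "nat \<Rightarrow> (real \<Rightarrow> 'a set set) \<Rightarrow> real \<Rightarrow> real \<Rightarrow> int" where
  "persistence_multiplicity k K b d =
     (THE m. \<forall>\<^sub>F \<epsilon> in at_right 0.
        m = (int (persistent_betti k K b (d - \<epsilon>)) - int (persistent_betti k K (b - \<epsilon>) (d - \<epsilon>)))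
          - (int (persistent_betti k K b d) - int (persistent_betti k K (b - \<epsilon>) d)))"

definition persistence_pairs :: "nat \<Rightarrow> (real \<Rightarrow> 'a set set) \<Rightarrow> (real \<times> real) set" where
  "persistence_pairs k K = {(b, d). b < d \<and> persistence_multiplicity k K b d \<noteq> 0}"

text \<open>
  The sum runs over the pairs with finite death value, counted with multiplicity; as usual, the
  essential class that lives forever does not contribute.
\<close>

definition lifetime_sum :: "real \<Rightarrow> 'a::metric_space set \<Rightarrow> real" where
  "lifetime_sum \<alpha> W =
     (\<Sum>(b, d)\<in>persistence_pairs 0 (rips W).
        of_int (persistence_multiplicity 0 (rips W) b d) * (d - b) powr \<alpha>)"

definition ph0_dimension :: "'a::metric_space set \<Rightarrow> ereal" where
  "ph0_dimension X =
     Inf (ereal ` {\<alpha>. \<alpha> > 0 \<and>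
       (\<exists>C>0. \<forall>W. finite W \<and> W \<subseteq> X \<longrightarrow> lifetime_sum \<alpha> W < C)})"

end

theory Submission
  imports Defs "HOL-Probability.Probability" "HOL-Real_Asymp.Real_Asymp" "Jordan_Normal_Form.Determinant"
begin

text \<open>
  Both dimensions are compared with the growth of packing numbers.

  In degree zero every class is born at \<open>0\<close>, and the number of classes surviving at scale \<open>r\<close> is at
  most the size of a maximal \<open>r\<close>-separated subset. A dyadic decomposition of the lifetimes bounds
  \<open>E\<^sub>\<alpha>\<close> for every \<open>\<alpha>\<close> above the Minkowski dimension; conversely all lifetimes of a
  \<open>\<delta>\<close>-separated set exceed \<open>\<delta>\<close>. So the persistent homology dimension is always the upper
  Minkowski dimension.

  For the magnitude, \<open>exp (- dist x y)\<close> is realised as the measure of the set of all balls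
  that contain both \<open>x\<close> and \<open>y\<close>, for a translation invariant measure on the space of balls in
  \<open>\<real>\<^sup>n\<close>. The quadratic form of the similarity matrix is then a squared \<open>L\<^sup>2\<close> norm, and
  Cauchy-Schwarz on balls of radius between 1/2 and 1 bounds it from below by
  \<open>(\<Sum>w)\<^sup>2\<close> divided by a covering number. This gives \<open>Mag (tX) \<le> C N(1/t)\<close>; testing the form on the
  indicator function of a separated set gives the reverse inequality. Hence
  \<open>ln Mag (tX)\<close> and \<open>ln N(1/t)\<close> differ by a bounded amount.
\<close>

section \<open>Degree-zero persistent homology of finite metric spaces\<close>

text \<open>A weighting may have negative entries, so neither bound on the magnitude can be had by
  adding up contributions of pieces of the set; both have to pass through the quadratic form. The
  lower bound on that form must be local in space, which is what a positive measure on balls offers: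
  keeping only balls with radius between two constants preserves the same share of every point's
  mass and makes distant points invisible to each other. Very small balls, on the other hand,
  isolate each point of a finite set; this gives strict definiteness and hence the existence of all
  finite magnitudes. The measure originates on the line, where the integral of
  \<open>exp (- 2 * max \<bar>s\<bar> \<bar>s - d\<bar>)\<close> over \<open>s\<close> is
  \<open>exp (- d)\<close>. Writing \<open>exp (- 2 * u)\<close> as a mixture of Gaussians in
  \<open>u\<close> carries this to every dimension, since each coordinate orthogonal to the segment
  contributes a Gaussian factor that can be divided out. A Gaussian of the larger of two distances
  is in turn a superposition of indicators of balls containing both points.\<close>

interpretation chain: vector_space chain_scale
  by (rule vector_space_chain_scale)

text \<open>Because the coefficient field is finite, the chains of a finite complex form a finite
  set. Every set whose dimension is compared below is therefore finite, and so are the bases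
  extracted from it.\<close>

lemma finite_chains:
  assumes "finite K" shows "finite (chains k K)"
proof -
  have "finite {f :: 'a set \<Rightarrow> bit. \<forall>x. (x \<in> K \<longrightarrow> f x \<in> {0, 1}) \<and> (x \<notin> K \<longrightarrow> f x = 0)}"
    by (intro finite_set_of_finite_funs assms) simp
  moreover have "Poly_Mapping.lookup ` chains k K \<subseteq> {f :: 'a set \<Rightarrow> bit. \<forall>x. (x \<in> K \<longrightarrow> f x \<in> {0, 1}) \<and> (x \<notin> K \<longrightarrow> f x = 0)}"
    using bit_not_zero_iff by (auto simp: chains_def in_keys_iff)
  ultimately have "finite (Poly_Mapping.lookup ` chains k K :: ('a set \<Rightarrow> bit) set)"
    by (rule finite_subset[rotated])
  then show ?thesis
    by (rule finite_imageD) (auto simp: inj_on_def poly_mapping_eqI)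
qed

lemma boundary_single: "boundary (Poly_Mapping.single \<sigma> 1) = simplex_boundary \<sigma>"
  by (simp add: boundary_def)

lemma boundary_zero: "boundary 0 = 0"
  by (simp add: boundary_def)

lemma simplex_boundary_edge:
  assumes "x \<noteq> y"
  shows "simplex_boundary {x, y} = Poly_Mapping.single {x} 1 + Poly_Mapping.single {y} 1"
proof -
  have "{x, y} - {x} = {y}" "{x, y} - {y} = {x}" using assms by auto
  then show ?thesis using assms by (simp add: simplex_boundary_def add.commute)
qed

lemma boundary_zero_chain:
  assumes "c \<in> chains 0 K" shows "boundary c = 0"
  using assms unfolding boundary_def chains_def
  by (intro sum.neutral) (auto simp: simplex_boundary_def)

lemma cycles_0: "cycles 0 K = chains 0 K"
  by (auto simp: cycles_def boundary_zero_chain)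

lemma chains_0_rips:
  assumes "0 \<le> s" shows "chains 0 (rips W s) = chains 0 (rips W 0)"
proof -
  have "\<sigma> \<in> rips W s \<longleftrightarrow> \<sigma> \<in> rips W 0" if "card \<sigma> = Suc 0" for \<sigma>
    using that assms by (auto simp: rips_def card_1_singleton_iff)
  then show ?thesis by (auto simp: chains_def)
qed

lemma rips_neg: "s < 0 \<Longrightarrow> rips W s = {}"
  by (fastforce simp: rips_def)

lemma chains_empty: "chains k {} = {0}"
  by (auto simp: chains_def)

text \<open>The number of vertices minus this rank is the number of connected components at scale \<open>t\<close>.\<close>

definition rips_rank :: "'a::metric_space set \<Rightarrow> real \<Rightarrow> nat" where
  "rips_rank W t = chain.dim (chains 0 (rips W 0) \<inter> boundaries 0 (rips W t))"

lemma finite_rips: "finite W \<Longrightarrow> finite (rips W t)"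
  by (rule finite_subset[of _ "Pow W"]) (auto simp: rips_def)

lemma rips_mono: "s \<le> t \<Longrightarrow> rips W s \<subseteq> rips W t"
  by (fastforce simp: rips_def)

text \<open>The ambient chain space may be infinite-dimensional; the comparison goes through a basis
  extracted from the finite set \<open>B\<close>.\<close>

lemma dim_mono_finite:
  assumes "A \<subseteq> chain.span B" "finite B" shows "chain.dim A \<le> chain.dim B"
proof -
  obtain b where b: "b \<subseteq> B" "chain.independent b" "B \<subseteq> chain.span b" "card b = chain.dim B"
    by (rule chain.basis_exists)
  have "A \<subseteq> chain.span b"
    using assms(1) b(3) by (meson chain.span_minimal chain.subspace_span dual_order.trans)
  then show ?thesis
    using chain.dim_le_card[of A b] b assms(2) finite_subset by metis
qed

lemma rips_rank_mono:
  assumes "finite W" "s \<le> t" shows "rips_rank W s \<le> rips_rank W t"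
proof -
  have "chains 1 (rips W s) \<subseteq> chains 1 (rips W t)"
    using rips_mono[OF assms(2), of W] by (auto simp: chains_def)
  then have "boundaries 0 (rips W s) \<subseteq> boundaries 0 (rips W t)"
    by (auto simp: boundaries_def)
  then show ?thesis
    unfolding rips_rank_def using assms
    by (intro dim_mono_finite finite_Int disjI1 finite_chains finite_rips)
      (auto intro: chain.span_base)
qed

lemma rips_rank_cong: "rips W s = rips W t \<Longrightarrow> rips_rank W s = rips_rank W t"
  by (simp add: rips_rank_def)

lemma rips_rank_le:
  assumes "finite W" shows "rips_rank W t \<le> chain.dim (chains 0 (rips W 0))"
  unfolding rips_rank_def using assms
  by (intro dim_mono_finite finite_chains finite_rips) (auto intro: chain.span_base)

lemma chains_0_decompose:
  assumes "c \<in> chains 0 (rips W 0)"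
  shows "c \<in> chain.span ((\<lambda>x. Poly_Mapping.single {x} 1) ` W)"
proof -
  have "c = (\<Sum>\<sigma>\<in>Poly_Mapping.keys c. chain_scale (Poly_Mapping.lookup c \<sigma>) (Poly_Mapping.single \<sigma> 1))"
    by (rule poly_mapping_eqI)
      (auto simp: lookup_sum chain_scale_def Poly_Mapping.map.rep_eq lookup_single when_def in_keys_iff sum.delta' if_distrib cong: if_cong)
  also have "\<dots> \<in> chain.span ((\<lambda>x. Poly_Mapping.single {x} 1) ` W)"
  proof (intro chain.span_sum chain.span_scale chain.span_base)
    fix \<sigma> assume "\<sigma> \<in> Poly_Mapping.keys c"
    then have "\<sigma> \<in> rips W 0" "card \<sigma> = 1" using assms by (auto simp: chains_def)
    then obtain x where "\<sigma> = {x}" "x \<in> W" by (auto simp: rips_def card_1_singleton_iff)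
    then show "Poly_Mapping.single \<sigma> (1::bit) \<in> (\<lambda>x. Poly_Mapping.single {x} 1) ` W" by blast
  qed
  finally show ?thesis .
qed

lemma dim_chains_0:
  assumes "finite W" shows "card W \<le> chain.dim (chains 0 (rips W 0))"
proof -
  let ?e = "\<lambda>x :: 'a. Poly_Mapping.single {x} (1::bit)"
  have inj: "inj_on ?e W"
  proof (rule inj_onI)
    fix x y assume "?e x = ?e y"
    then have "Poly_Mapping.keys (?e x) = Poly_Mapping.keys (?e y)" by simp
    then show "x = y" by simp
  qed
  have "chain.independent (?e ` W)"
  proof (rule chain.independent_if_scalars_zero)
    fix f x assume 0: "(\<Sum>x\<in>?e ` W. chain_scale (f x) x) = 0" and "x \<in> ?e ` W"
    then obtain w where w: "w \<in> W" "x = ?e w" by auto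
    have "0 = Poly_Mapping.lookup (\<Sum>x\<in>?e ` W. chain_scale (f x) x) {w}" by (simp only: 0 lookup_zero)
    also have "\<dots> = (\<Sum>v\<in>W. if v = w then f (?e v) else 0)"
      unfolding sum.reindex[OF inj] lookup_sum o_def
      by (intro sum.cong) (auto simp: chain_scale_def Poly_Mapping.map.rep_eq lookup_single when_def)
    also have "\<dots> = f x" using w assms by (simp)
    finally show "f x = 0" by simp
  qed (use assms in auto)
  then have "card (?e ` W) \<le> chain.dim (chains 0 (rips W 0))"
    by (subst chain.dim_eq_card_independent[symmetric], assumption)
     (intro dim_mono_finite finite_chains finite_rips assms, auto intro!: chain.span_base simp: chains_def rips_def)
  then show ?thesis by (simp add: card_image[OF inj])
qed

text \<open>Modulo boundaries at scale \<open>t\<close> each vertex equals a nearby point of the net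
  \<open>P\<close>, through the edge joining them. A basis of the boundaries together with the
  vertices in \<open>P\<close> thus spans all 0-chains, so at most \<open>card P\<close> components
  remain at scale \<open>t\<close>.\<close>

lemma rips_rank_ge:
  assumes "finite W" "P \<subseteq> W" and cover: "\<And>w. w \<in> W \<Longrightarrow> \<exists>p\<in>P. dist w p \<le> t" and "0 \<le> t"
  shows "card W \<le> rips_rank W t + card P"
proof -
  let ?e = "\<lambda>x :: 'a. Poly_Mapping.single {x} (1::bit)"
  let ?S = "chains 0 (rips W 0) \<inter> boundaries 0 (rips W t)"
  have fS: "finite ?S" using assms by (simp add: finite_chains finite_rips)
  obtain b where b: "b \<subseteq> ?S" "chain.independent b" "?S \<subseteq> chain.span b" "card b = chain.dim ?S"
    by (rule chain.basis_exists)
  have fb: "finite b" using b(1) fS by (rule finite_subset)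
  have "?e w \<in> chain.span (b \<union> ?e ` P)" if w: "w \<in> W" for w
  proof -
    obtain p where p: "p \<in> P" "dist w p \<le> t" using cover w by auto
    have pe: "?e p \<in> chain.span (b \<union> ?e ` P)" using p by (auto intro: chain.span_base)
    show ?thesis
    proof (cases "w = p")
      case False
      have "boundary (Poly_Mapping.single {w, p} 1) = ?e w + ?e p"
        using False by (simp add: boundary_single simplex_boundary_edge)
      moreover have "Poly_Mapping.single {w, p} (1::bit) \<in> chains 1 (rips W t)"
        using p w False assms by (auto simp: chains_def rips_def dist_commute)
      ultimately have "?e w + ?e p \<in> boundaries 0 (rips W t)"
        by (metis boundaries_def One_nat_def image_eqI)
      moreover have "?e w + ?e p \<in> chains 0 (rips W 0)"
      proof -
        have "Poly_Mapping.keys (?e w + ?e p) \<subseteq> {{w}, {p}}"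
          using keys_add[of "?e w" "?e p"] by (simp add: insert_commute)
        moreover have "{w} \<in> rips W 0" "{p} \<in> rips W 0" using p w assms(2) by (auto simp: rips_def)
        ultimately show ?thesis unfolding chains_def by auto
      qed
      ultimately have "?e w + ?e p \<in> chain.span (b \<union> ?e ` P)"
        using b(3) chain.span_mono[of b "b \<union> ?e ` P"] by blast
      from chain.span_diff[OF this pe] show ?thesis by simp
    qed (use pe in simp)
  qed
  then have "chain.span (?e ` W) \<subseteq> chain.span (b \<union> ?e ` P)"
    by (intro chain.span_minimal chain.subspace_span) auto
  then have "chains 0 (rips W 0) \<subseteq> chain.span (b \<union> ?e ` P)"
    using chains_0_decompose by blast
  then have "chain.dim (chains 0 (rips W 0)) \<le> card (b \<union> ?e ` P)"
    using fb finite_subset[OF assms(2,1)] by (intro chain.dim_le_card) auto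
  also have "\<dots> \<le> card b + card P"
    by (meson assms card_Un_le card_image_le dual_order.trans finite_subset add_left_mono)
  finally show ?thesis using dim_chains_0[OF assms(1)] b(4) by (simp add: rips_rank_def)
qed

lemma rips_rank_eq_0:
  assumes "\<And>x y. x \<in> W \<Longrightarrow> y \<in> W \<Longrightarrow> x \<noteq> y \<Longrightarrow> t < dist x y"
  shows "rips_rank W t = 0"
proof -
  have "\<sigma> \<notin> rips W t" if c: "card \<sigma> = Suc (Suc 0)" for \<sigma>
  proof
    assume "\<sigma> \<in> rips W t"
    moreover obtain x y where "\<sigma> = {x, y}" "x \<noteq> y" using c card_2_iff[of \<sigma>] by (auto simp: numeral_2_eq_2)
    ultimately show False using assms by (force simp: rips_def)
  qed
  then have "chains 1 (rips W t) \<subseteq> {0}" by (auto simp: chains_def) (metis keys_eq_empty all_not_in_conv)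
  then have "boundaries 0 (rips W t) \<subseteq> {0}" by (auto simp: boundaries_def boundary_zero)
  then have "chain.dim (chains 0 (rips W 0) \<inter> boundaries 0 (rips W t)) \<le> card ({} :: ('a set \<Rightarrow>\<^sub>0 bit) set)"
    by (intro chain.dim_le_card) auto
  then show ?thesis by (simp add: rips_rank_def)
qed

text \<open>Below scale 0 the complex is empty. For \<open>b = 0\<close> this removes the
  \<open>b - \<epsilon>\<close> terms from the multiplicity, which is how all births come to be
  recorded at 0.\<close>

lemma persistent_betti_neg:
  fixes W :: "'a::metric_space set"
  shows "s < 0 \<Longrightarrow> persistent_betti 0 (rips W) s t = 0"
  using chain.dim_le_card[of "{0}" "{} :: ('a set \<Rightarrow>\<^sub>0 bit) set"]
  by (simp add: persistent_betti_def cycles_0 rips_neg chains_empty)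

lemma persistent_betti_nonneg:
  assumes "finite W" "0 \<le> s"
  shows "int (persistent_betti 0 (rips W) s t) = int (chain.dim (chains 0 (rips W 0))) - int (rips_rank W t)"
  unfolding persistent_betti_def cycles_0 chains_0_rips[OF assms(2)] rips_rank_def[symmetric]
  using rips_rank_le[OF assms(1), of t] by (simp add: of_nat_diff)

lemma dim_chains_0_le:
  assumes "finite W" shows "chain.dim (chains 0 (rips W 0)) \<le> card W"
proof -
  let ?e = "\<lambda>x :: 'a. Poly_Mapping.single {x} (1::bit)"
  have "chain.dim (chains 0 (rips W 0)) \<le> card (?e ` W)"
    using assms chains_0_decompose by (intro chain.dim_le_card) auto
  then show ?thesis using card_image_le[OF assms, of ?e] by linarith
qed

section \<open>Critical scales and the bars of the degree-zero barcode\<close>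

lemma rips_cong:
  assumes "s \<le> t" and none: "\<And>x y. x \<in> W \<Longrightarrow> y \<in> W \<Longrightarrow> dist x y \<le> t \<Longrightarrow> dist x y \<le> s"
  shows "rips W t = rips W s"
proof
  show "rips W t \<subseteq> rips W s"
    using none unfolding rips_def by blast
qed (rule rips_mono[OF assms(1)])

text \<open>The critical values of the filtration: after 0 the complex changes only at these
  scales.\<close>

definition positive_distances :: "'a::metric_space set \<Rightarrow> real set" where
  "positive_distances W = {r \<in> (\<lambda>(x, y). dist x y) ` (W \<times> W). 0 < r}"

lemma finite_positive_distances: "finite W \<Longrightarrow> finite (positive_distances W)"
  by (simp add: positive_distances_def)

lemma dist_in_positive_distances:
  "x \<in> W \<Longrightarrow> y \<in> W \<Longrightarrow> x \<noteq> y \<Longrightarrow> dist x y \<in> positive_distances W"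
  by (auto simp: positive_distances_def)

lemma rips_rank_const:
  assumes "0 \<le> s" "s \<le> t" "positive_distances W \<inter> {s<..t} = {}"
  shows "rips_rank W t = rips_rank W s"
proof (intro rips_rank_cong rips_cong assms)
  fix x y assume "x \<in> W" "y \<in> W" "dist x y \<le> t"
  show "dist x y \<le> s"
  proof (cases "x = y")
    case False
    then have "dist x y \<notin> {s<..t}" 
      using assms(3) dist_in_positive_distances \<open>x \<in> W\<close> \<open>y \<in> W\<close> by blast
    then show ?thesis using \<open>dist x y \<le> t\<close> by simp
  qed (use assms in simp)
qed

text \<open>Left limit of the step function \<open>rips_rank W\<close>; the
  \<open>d - \<epsilon>\<close> terms of the multiplicity settle at this value.\<close>

definition rank_left :: "'a::metric_space set \<Rightarrow> real \<Rightarrow> nat" where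
  "rank_left W d = (THE n. \<forall>\<^sub>F s in at_left d. rips_rank W s = n)"

lemma rank_left_eq:
  assumes "0 \<le> a" "a < d" "positive_distances W \<inter> {a<..<d} = {}"
  shows "rank_left W d = rips_rank W a" "\<forall>\<^sub>F s in at_left d. rips_rank W s = rank_left W d"
proof -
  have 1: "\<forall>\<^sub>F s in at_left d. rips_rank W s = rips_rank W a"
    using eventually_at_left_real[OF assms(2)]
  proof eventually_elim
    case (elim s)
    then have "positive_distances W \<inter> {a<..s} = {}" using assms(3) by force
    then show ?case using elim assms(1) by (intro rips_rank_const) auto
  qed
  have "n = rips_rank W a" if "\<forall>\<^sub>F s in at_left d. rips_rank W s = n" for n
    using eventually_happens[OF eventually_conj[OF 1 that]] by auto
  with 1 show "rank_left W d = rips_rank W a"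
    unfolding rank_left_def by (intro the_equality)
  with 1 show "\<forall>\<^sub>F s in at_left d. rips_rank W s = rank_left W d" by simp
qed

text \<open>Supplies the gap without critical values just before \<open>d\<close>, on which the rank
  is constant. The point \<open>a\<close> serves as a floor if no distance lies between
  \<open>a\<close> and \<open>d\<close>.\<close>

lemma previous_distance:
  assumes "finite W" "a < d"
  obtains b where "a \<le> b" "b < d" "positive_distances W \<inter> {b<..<d} = {}"
    "b = a \<or> b \<in> positive_distances W"
proof -
  define D where "D = insert a (positive_distances W \<inter> {a<..<d})"
  have fin: "finite D" using assms by (simp add: D_def finite_positive_distances)
  have m: "Max D \<in> D" "a \<le> Max D"
    using Max_in[OF fin] Max_ge[OF fin, of a] by (auto simp: D_def)
  show thesis
  proof (rule that)
    show "Max D < d" using m(1) assms by (auto simp: D_def)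
    have "r \<notin> {Max D<..<d}" if "r \<in> positive_distances W" for r
    proof
      assume "r \<in> {Max D<..<d}"
      then have "r \<in> D" using that m(2) by (auto simp: D_def)
      then show False using Max_ge[OF fin] \<open>r \<in> {Max D<..<d}\<close> by force
    qed
    then show "positive_distances W \<inter> {Max D<..<d} = {}" by blast
  qed (use m in \<open>auto simp: D_def\<close>)
qed

text \<open>All vertices are present from scale 0 on. For \<open>b > 0\<close> the terms at
  \<open>b\<close> and \<open>b - \<epsilon>\<close> therefore cancel, for \<open>b < 0\<close> all
  terms vanish, and for \<open>b = 0\<close> what is left is the drop in the number of components at
  \<open>d\<close>, that is, the jump of the rank.\<close>

lemma persistence_multiplicity_rips:
  assumes "finite W" "b < d"
  shows "persistence_multiplicity 0 (rips W) b d =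
    (if b = 0 then int (rips_rank W d) - int (rank_left W d) else 0)"
    (is "_ = ?m")
proof -
  let ?B = "persistent_betti 0 (rips W)"
  let ?f = "\<lambda>\<epsilon>. (int (?B b (d - \<epsilon>)) - int (?B (b - \<epsilon>) (d - \<epsilon>))) - (int (?B b d) - int (?B (b - \<epsilon>) d))"
  have e: "\<forall>\<^sub>F \<epsilon> in at_right 0. ?f \<epsilon> = ?m"
  proof (cases "b < 0 \<or> b = 0")
    case True
    then show ?thesis
    proof
      assume "b < 0"
      show ?thesis using eventually_at_right_less[of "0::real"]
        by eventually_elim (use \<open>b < 0\<close> in \<open>auto simp: persistent_betti_neg\<close>)
    next
      assume b: "b = 0"
      then have "0 < d" using assms by simp
      then obtain a where "0 \<le> a" "a < d" "positive_distances W \<inter> {a<..<d} = {}"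
        using previous_distance[OF assms(1)] by metis
      from rank_left_eq(2)[OF this]
      have "\<forall>\<^sub>F s in at_left d. rips_rank W s = rank_left W d" .
      moreover have "filterlim (\<lambda>\<epsilon>. d - \<epsilon>) (at_left d) (at_right 0)" by real_asymp
      ultimately have "\<forall>\<^sub>F \<epsilon> in at_right 0. rips_rank W (d - \<epsilon>) = rank_left W d"
        by (rule eventually_compose_filterlim)
      with eventually_at_right_less[of "0::real"] show ?thesis
        by eventually_elim (use b in \<open>simp add: persistent_betti_neg persistent_betti_nonneg assms\<close>)
    qed
  next
    case False
    then have b: "0 < b" by simp
    show ?thesis using eventually_at_right_real[OF b]
      by eventually_elim (use b in \<open>simp add: persistent_betti_nonneg assms\<close>)
  qed
  show ?thesis unfolding persistence_multiplicity_def
  proof (rule the_equality)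
    show "\<forall>\<^sub>F \<epsilon> in at_right 0. ?m = ?f \<epsilon>" using e by (rule eventually_mono) simp
    fix m assume "\<forall>\<^sub>F \<epsilon> in at_right 0. m = ?f \<epsilon>"
    from eventually_happens[OF eventually_conj[OF this e]] show "m = ?m" by auto
  qed
qed

text \<open>The number of bars ending at \<open>d\<close>, as a real difference so that sums over
  consecutive critical values telescope.\<close>

definition deaths :: "'a::metric_space set \<Rightarrow> real \<Rightarrow> real" where
  "deaths W d = real (rips_rank W d) - real (rank_left W d)"

lemma deaths_nonneg:
  assumes "finite W" "0 < d" shows "0 \<le> deaths W d"
proof -
  obtain a where a: "0 \<le> a" "a < d" "positive_distances W \<inter> {a<..<d} = {}"
    using previous_distance[OF assms] by metis
  show ?thesis
    using rank_left_eq(1)[OF a] rips_rank_mono[OF assms(1), of a d] a by (simp add: deaths_def)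
qed

text \<open>Every bar is born at 0, so its lifetime is its death value, and a death can occur only
  at a critical value. Critical values without a death have multiplicity 0 and may be included in
  the sum.\<close>

lemma lifetime_sum_eq:
  assumes "finite W"
  shows "lifetime_sum \<alpha> W = (\<Sum>d\<in>positive_distances W. deaths W d * d powr \<alpha>)"
proof -
  have sub: "persistence_pairs 0 (rips W) \<subseteq> Pair 0 ` positive_distances W"
  proof clarify
    fix b d assume "(b, d) \<in> persistence_pairs 0 (rips W)"
    then have bd: "b < d" "persistence_multiplicity 0 (rips W) b d \<noteq> 0"
      by (auto simp: persistence_pairs_def)
    then have b: "b = 0" and ne: "rips_rank W d \<noteq> rank_left W d"
      using persistence_multiplicity_rips[OF assms bd(1)] by (auto split: if_splits)
    have "0 < d" using bd b by simp
    obtain a where a: "0 \<le> a" "a < d" "positive_distances W \<inter> {a<..<d} = {}"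
      using previous_distance[OF assms \<open>0 < d\<close>] by metis
    have "d \<in> positive_distances W"
    proof (rule ccontr)
      assume "d \<notin> positive_distances W"
      then have "positive_distances W \<inter> {a<..d} = {}"
        using a(3) by (auto simp: less_le)
      then have "rips_rank W d = rips_rank W a" using a by (intro rips_rank_const) auto
      with ne rank_left_eq(1)[OF a] show False by simp
    qed
    with b show "(b, d) \<in> Pair 0 ` positive_distances W" by blast
  qed
  have "lifetime_sum \<alpha> W = (\<Sum>(b, d)\<in>Pair 0 ` positive_distances W.
      of_int (persistence_multiplicity 0 (rips W) b d) * (d - b) powr \<alpha>)"
    unfolding lifetime_sum_def
    by (rule sum.mono_neutral_left)
      (use sub finite_positive_distances[OF assms] in \<open>auto simp: persistence_pairs_def positive_distances_def\<close>)
  also have "\<dots> = (\<Sum>d\<in>positive_distances W. deaths W d * d powr \<alpha>)"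
    by (subst sum.reindex) (auto simp: inj_on_def o_def deaths_def persistence_multiplicity_rips assms positive_distances_def intro!: sum.cong)
  finally show ?thesis .
qed

text \<open>Telescoping of the jumps of a step function. The induction removes the largest critical
  value \<open>m\<close> and continues from the preceding one, or from \<open>a\<close>.\<close>

lemma sum_deaths:
  assumes "finite W" "0 \<le> a" "a \<le> b"
  shows "(\<Sum>d\<in>positive_distances W \<inter> {a<..b}. deaths W d) = real (rips_rank W b) - real (rips_rank W a)"
  using assms(3)
proof (induction "card (positive_distances W \<inter> {a<..b})" arbitrary: b rule: less_induct)
  case less
  let ?D = "positive_distances W \<inter> {a<..b}"
  have fin: "finite ?D" using assms by (simp add: finite_positive_distances)
  show ?case
  proof (cases "?D = {}")
    case True
    then show ?thesis using rips_rank_const[OF assms(2) less.prems] by simp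
  next
    case False
    define m where "m = Max ?D"
    have m: "m \<in> ?D" unfolding m_def by (rule Max_in[OF fin False])
    have le: "d \<le> m" if "d \<in> ?D" for d unfolding m_def by (rule Max_ge[OF fin that])
    obtain c where c: "a \<le> c" "c < m" "positive_distances W \<inter> {c<..<m} = {}"
      using previous_distance[OF assms(1), of a m] m by auto
    have split: "?D = insert m (positive_distances W \<inter> {a<..c})"
    proof (intro equalityI subsetI)
      fix d assume d: "d \<in> ?D"
      then have "d \<le> m" "d \<notin> {c<..<m}" using le c(3) by auto
      then show "d \<in> insert m (positive_distances W \<inter> {a<..c})" using d by auto
    qed (use m c in auto)
    have nm: "m \<notin> positive_distances W \<inter> {a<..c}" using c by auto
    have "card (positive_distances W \<inter> {a<..c}) < card ?D"
      unfolding split using nm fin by (subst card_insert_disjoint) (auto simp: assms finite_positive_distances)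
    from less.hyps[OF this c(1)]
    have IH: "(\<Sum>d\<in>positive_distances W \<inter> {a<..c}. deaths W d) = real (rips_rank W c) - real (rips_rank W a)" .
    have "rips_rank W b = rips_rank W m"
    proof (rule rips_rank_const)
      show "positive_distances W \<inter> {m<..b} = {}" using le m by force
    qed (use m assms in auto)
    moreover have "rank_left W m = rips_rank W c"
      by (rule rank_left_eq(1)) (use c assms in auto)
    ultimately show ?thesis
      unfolding split using nm IH by (subst sum.insert) (auto simp: deaths_def assms finite_positive_distances)
  qed
qed

section \<open>Separated sets and bounds on lifetime sums\<close>

definition separated :: "real \<Rightarrow> 'a::metric_space set \<Rightarrow> bool" where
  "separated r S \<longleftrightarrow> (\<forall>x\<in>S. \<forall>y\<in>S. x \<noteq> y \<longrightarrow> r < dist x y)"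

text \<open>A separated set of greatest cardinality cannot be enlarged and is therefore a net;
  \<open>N\<close> guarantees that a greatest cardinality exists. Since separation is strict, its
  failure is the closed condition \<open>dist x p \<le> r\<close>, the same as for Rips
  edges.\<close>

lemma maximal_separated:
  fixes X :: "'a::metric_space set"
  assumes "0 \<le> r" and bound: "\<And>S. finite S \<Longrightarrow> S \<subseteq> X \<Longrightarrow> separated r S \<Longrightarrow> card S \<le> N"
  obtains P where "finite P" "P \<subseteq> X" "separated r P" "\<And>x. x \<in> X \<Longrightarrow> \<exists>p\<in>P. dist x p \<le> r"
proof -
  let ?Q = "\<lambda>S. finite S \<and> S \<subseteq> X \<and> separated r S"
  have "?Q {}" by (simp add: separated_def)
  then obtain P where P: "?Q P" and max: "\<And>S. ?Q S \<Longrightarrow> card S \<le> card P"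
    using ex_has_greatest_nat[of ?Q "{}" card "Suc N"] bound by (metis less_Suc_eq_le)
  show thesis
  proof (rule that)
    fix x assume x: "x \<in> X"
    show "\<exists>p\<in>P. dist x p \<le> r"
    proof (rule ccontr)
      assume n: "\<not> ?thesis"
      then have "x \<notin> P" using assms(1) by force
      moreover have "?Q (insert x P)" using P x n by (auto simp: separated_def dist_commute not_le)
      ultimately show False using max[of "insert x P"] P by auto
    qed
  qed (use P in auto)
qed

text \<open>There are \<open>card P - 1\<close> bars of finite length, one for each merging of
  components until a single one is left. Each ends at a distance between points of \<open>P\<close>,
  hence beyond \<open>\<delta>\<close>.\<close>

lemma lifetime_sum_separated:
  assumes "finite P" "separated \<delta> P" "0 < \<delta>" "0 < \<alpha>"
  shows "(real (card P) - 1) * \<delta> powr \<alpha> \<le> lifetime_sum \<alpha> P"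
proof (cases "P = {}")
  case True
  then show ?thesis by (simp add: lifetime_sum_eq positive_distances_def)
next
  case False
  then obtain p where p: "p \<in> P" by auto
  obtain T where T: "0 \<le> T" "\<And>d. d \<in> positive_distances P \<Longrightarrow> d \<le> T"
    using finite_positive_distances[OF assms(1)]
    by (metis Max_ge finite_insert insertCI)
  have all: "positive_distances P \<inter> {0<..T} = positive_distances P"
  proof -
    have "0 < d" if "d \<in> positive_distances P" for d using that by (simp add: positive_distances_def)
    with T(2) show ?thesis by auto
  qed
  \<comment> \<open>At scale \<open>T\<close>, above all distances, one point already is a net, so
    the rank is at least \<open>card P - 1\<close>.\<close>
  have "real (card P) \<le> rips_rank P T + card {p}"
    unfolding of_nat_add[symmetric] of_nat_le_iff
  proof (rule rips_rank_ge)
    fix w assume "w \<in> P"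
    then show "\<exists>p\<in>{p}. dist w p \<le> T"
      using T(1) T(2)[OF dist_in_positive_distances] p by (cases "w = p") auto
  qed (use T p assms in auto)
  moreover have "rips_rank P 0 = 0" by (rule rips_rank_eq_0) auto
  ultimately have "real (card P) - 1 \<le> (\<Sum>d\<in>positive_distances P. deaths P d)"
    using sum_deaths[OF assms(1) order_refl T(1)] unfolding all by simp
  then have "(real (card P) - 1) * \<delta> powr \<alpha> \<le> (\<Sum>d\<in>positive_distances P. deaths P d) * \<delta> powr \<alpha>"
    by (intro mult_right_mono) auto
  also have "\<dots> \<le> (\<Sum>d\<in>positive_distances P. deaths P d * d powr \<alpha>)"
    unfolding sum_distrib_right using assms
    by (intro sum_mono mult_left_mono powr_mono2 deaths_nonneg)
       (auto simp: positive_distances_def separated_def intro: less_imp_le)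
  finally show ?thesis by (simp add: lifetime_sum_eq assms)
qed

text \<open>A bar that ends after \<open>r\<close> is a component still alive at scale
  \<open>r\<close>, and these are at most as many as the points of an \<open>r\<close>-net.\<close>

lemma sum_deaths_le:
  assumes "finite W" "0 \<le> r" "r \<le> T" and bound: "\<And>S. S \<subseteq> W \<Longrightarrow> separated r S \<Longrightarrow> card S \<le> N"
  shows "(\<Sum>d\<in>positive_distances W \<inter> {r<..T}. deaths W d) \<le> N"
proof -
  obtain P where P: "finite P" "P \<subseteq> W" "separated r P" "\<And>x. x \<in> W \<Longrightarrow> \<exists>p\<in>P. dist x p \<le> r"
    using maximal_separated[OF assms(2), of W N] bound by metis
  have "rips_rank W T \<le> card W"
    using rips_rank_le[OF assms(1), of T] dim_chains_0_le[OF assms(1)] by simp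
  moreover have "card W \<le> rips_rank W r + card P"
    using P assms by (intro rips_rank_ge) auto
  moreover have "card P \<le> N" using bound P by auto
  ultimately show ?thesis
    using sum_deaths[OF assms(1,2,3)] by linarith
qed

text \<open>Bars with length in \<open>(T / 2 ^ Suc k, T / 2 ^ k]\<close> number at most
  \<open>C * (T / 2 ^ Suc k) powr (- \<beta>)\<close> and contribute at most
  \<open>(T / 2 ^ k) powr \<alpha>\<close> each. The products form a geometric sequence, whose sum
  does not depend on \<open>W\<close>.\<close>

lemma lifetime_sum_le:
  fixes W :: "'a::metric_space set"
  assumes "finite W" "0 < T" "0 \<le> C" "\<beta> < \<alpha>" "0 < \<alpha>"
    and diam: "\<And>x y. x \<in> W \<Longrightarrow> y \<in> W \<Longrightarrow> dist x y \<le> T"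
    and bound: "\<And>r S. 0 < r \<Longrightarrow> r \<le> T \<Longrightarrow> S \<subseteq> W \<Longrightarrow> separated r S \<Longrightarrow> real (card S) \<le> C * r powr (- \<beta>)"
  shows "lifetime_sum \<alpha> W \<le> C * 2 powr \<beta> * T powr (\<alpha> - \<beta>) / (1 - 2 powr (\<beta> - \<alpha>))"
proof -
  let ?D = "positive_distances W"
  \<comment> \<open>Ratio between the bounds for consecutive dyadic windows; it is below 1 because
    \<open>\<beta> < \<alpha>\<close>.\<close>
  define q where "q = 2 powr (\<beta> - \<alpha>)"
  have q: "0 < q" "q < 1" using assms(4) by (simp_all add: q_def powr_less_one)
  define K where "K = C * 2 powr \<beta> * T powr (\<alpha> - \<beta>)"
  have K: "0 \<le> K" using assms by (simp add: K_def)
  have T0: "0 < T / 2 ^ k" "T / 2 ^ k \<le> T" for k using assms(2) by (simp_all add: divide_le_eq mult_le_cancel_left1)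
  have fin: "finite ?D" by (rule finite_positive_distances[OF assms(1)])
  have step: "(\<Sum>d\<in>?D \<inter> {T / 2 ^ Suc k<..T / 2 ^ k}. deaths W d * d powr \<alpha>) \<le> K * q ^ k" for k
  proof -
    let ?r = "T / 2 ^ Suc k"
    have r: "0 < ?r" "?r \<le> T / 2 ^ k" using assms(2) by (simp_all add: field_simps)
    have n0: "0 \<le> C * ?r powr (- \<beta>)" using assms(3) by simp
    have "(\<Sum>d\<in>?D \<inter> {?r<..T / 2 ^ k}. deaths W d) \<le> real (nat \<lfloor>C * ?r powr (- \<beta>)\<rfloor>)"
    proof (rule sum_deaths_le)
      fix S assume "S \<subseteq> W" "separated ?r S"
      then show "card S \<le> nat \<lfloor>C * ?r powr (- \<beta>)\<rfloor>"
        using bound[of ?r S] T0[of "Suc k"] by (intro le_nat_floor) auto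
    qed (use assms r in auto)
    also have "\<dots> \<le> C * ?r powr (- \<beta>)" using n0 by simp
    finally have *: "(\<Sum>d\<in>?D \<inter> {?r<..T / 2 ^ k}. deaths W d) \<le> C * ?r powr (- \<beta>)" .
    have "(\<Sum>d\<in>?D \<inter> {?r<..T / 2 ^ k}. deaths W d * d powr \<alpha>)
        \<le> (\<Sum>d\<in>?D \<inter> {?r<..T / 2 ^ k}. deaths W d * (T / 2 ^ k) powr \<alpha>)"
      using assms r by (intro sum_mono mult_left_mono powr_mono2 deaths_nonneg) (auto simp: positive_distances_def)
    also have "\<dots> \<le> C * ?r powr (- \<beta>) * (T / 2 ^ k) powr \<alpha>"
      unfolding sum_distrib_right[symmetric] by (intro mult_right_mono *) auto
    also have "\<dots> = K * q ^ k"
    proof -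
      define u where "u = T / 2 ^ k"
      have u: "0 < u" using assms(2) by (simp add: u_def)
      have ru: "?r = u / 2" by (simp add: u_def)
      have 1: "?r powr (- \<beta>) = u powr (- \<beta>) * 2 powr \<beta>"
        proof -
        have "(u / 2) powr (- \<beta>) = u powr (- \<beta>) / 2 powr (- \<beta>)"
          by (rule powr_divide)
        then show ?thesis unfolding ru by (simp only: powr_minus divide_inverse inverse_inverse_eq)
      qed
      have 2: "u powr (- \<beta>) * u powr \<alpha> = u powr (\<alpha> - \<beta>)"
        by (simp add: powr_add[symmetric])
      have "u powr (\<alpha> - \<beta>) = T powr (\<alpha> - \<beta>) * inverse ((2 ^ k) powr (\<alpha> - \<beta>))"
        unfolding u_def divide_inverse[of _ "_ powr _", symmetric] by (rule powr_divide)
      also have "(2 ^ k) powr (\<alpha> - \<beta>) = 2 powr (real k * (\<alpha> - \<beta>))"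
        proof -
        have "(2 ^ k :: real) = 2 powr real k" by (simp add: powr_realpow)
        then show ?thesis by (simp only: powr_powr)
      qed
      also have "inverse (2 powr (real k * (\<alpha> - \<beta>))) = q ^ k"
        proof -
        have "q ^ k = 2 powr (real k * (\<beta> - \<alpha>))" unfolding q_def by (rule powr_power) simp
        also have "real k * (\<beta> - \<alpha>) = - (real k * (\<alpha> - \<beta>))" by (simp add: algebra_simps)
        finally show ?thesis by (simp only: powr_minus)
      qed
      finally have 3: "u powr (\<alpha> - \<beta>) = T powr (\<alpha> - \<beta>) * q ^ k" .
      have "C * ?r powr (- \<beta>) * u powr \<alpha> = C * 2 powr \<beta> * (u powr (- \<beta>) * u powr \<alpha>)"
        unfolding 1 by (simp only: mult_ac)
      then show ?thesis unfolding 2 3 K_def u_def[symmetric] by (simp only: mult_ac)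
    qed
    finally show ?thesis .
  qed
  have part: "(\<Sum>d\<in>?D \<inter> {T / 2 ^ n<..}. deaths W d * d powr \<alpha>) \<le> K * (\<Sum>k<n. q ^ k)" for n
  proof (induction n)
    case 0
    have "?D \<inter> {T<..} = {}" using diam by (force simp: positive_distances_def)
    then show ?case by simp
  next
    case (Suc n)
    have le: "T / 2 ^ Suc n \<le> T / 2 ^ n" using assms(2) by (simp add: field_simps)
    have split: "?D \<inter> {T / 2 ^ Suc n<..} = (?D \<inter> {T / 2 ^ n<..}) \<union> (?D \<inter> {T / 2 ^ Suc n<..T / 2 ^ n})"
      using le by force
    have "(\<Sum>d\<in>?D \<inter> {T / 2 ^ Suc n<..}. deaths W d * d powr \<alpha>)
        = (\<Sum>d\<in>?D \<inter> {T / 2 ^ n<..}. deaths W d * d powr \<alpha>)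
        + (\<Sum>d\<in>?D \<inter> {T / 2 ^ Suc n<..T / 2 ^ n}. deaths W d * d powr \<alpha>)"
      unfolding split by (rule sum.union_disjoint) (use fin in auto)
    also have "\<dots> \<le> K * (\<Sum>k<n. q ^ k) + K * q ^ n"
      by (rule add_mono[OF Suc step])
    finally show ?case by (simp add: distrib_left)
  qed
  \<comment> \<open>A finite set has a smallest positive distance, so finitely many windows exhaust
    all bars.\<close>
  have "\<exists>n. \<forall>d\<in>?D. T / 2 ^ n < d"
  proof (cases "?D = {}")
    case False
    then have "0 < Min ?D" using fin by (subst Min_gr_iff) (auto simp: positive_distances_def)
    then obtain n where "T / Min ?D < 2 ^ n" using real_arch_pow[of 2 "T / Min ?D"] by auto
    then have "T / 2 ^ n < Min ?D" using \<open>0 < Min ?D\<close> by (simp add: field_simps)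
    then have "\<forall>d\<in>?D. T / 2 ^ n < d" using Min_le[OF fin] by (meson less_le_trans)
    then show ?thesis ..
  qed auto
  then obtain n where "?D \<inter> {T / 2 ^ n<..} = ?D" by blast
  then have "lifetime_sum \<alpha> W \<le> K * (\<Sum>k<n. q ^ k)"
    using part[of n] by (simp add: lifetime_sum_eq[OF assms(1)])
  also have "(\<Sum>k<n. q ^ k) \<le> 1 / (1 - q)"
    using q by (simp add: sum_gp_strict divide_right_mono)
  finally show ?thesis using K by (simp add: K_def q_def mult_left_mono)
qed

section \<open>The kernel \<open>exp (- dist x y)\<close> as a measure on balls\<close>

lemma gauss_antiderivative:
  obtains \<Phi> :: "real \<Rightarrow> real"
  where "\<And>y. (\<Phi> has_real_derivative exp (- y\<^sup>2)) (at y)"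
    and "(\<Phi> \<longlongrightarrow> sqrt pi / 2) at_top" and "(\<Phi> \<longlongrightarrow> - sqrt pi / 2) at_bot"
proof -
  obtain F where F: "\<And>y. (F has_real_derivative exp (- y\<^sup>2)) (at y)"
    using einterval_antiderivative[of "-\<infinity>" "\<infinity>" "\<lambda>y::real. exp (- y\<^sup>2)"]
    by (auto simp: has_real_derivative_iff_has_vector_derivative)
  define \<Phi> where "\<Phi> y = F y - F 0" for y
  have D: "(\<Phi> has_real_derivative exp (- y\<^sup>2)) (at y)" for y
    unfolding \<Phi>_def by (auto intro!: derivative_eq_intros F)
  have int: "integrable lborel (\<lambda>x. indicator {0..} x *\<^sub>R exp (- x\<^sup>2) :: real)"
    and val: "(\<integral>x. indicator {0..} x *\<^sub>R exp (- x\<^sup>2) \<partial>lborel) = sqrt pi / 2"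
    using gaussian_moment_0 by (auto simp: has_bochner_integral_iff)
  have lim: "((\<lambda>y. \<integral>x. indicator {..y} x *\<^sub>R (indicator {0..} x *\<^sub>R exp (- x\<^sup>2)) \<partial>lborel) \<longlongrightarrow> sqrt pi / 2) at_top"
    using tendsto_integral_at_top[OF _ int] unfolding val by simp
  have eq: "(\<integral>x. indicator {..y} x *\<^sub>R (indicator {0..} x *\<^sub>R exp (- x\<^sup>2)) \<partial>lborel) = \<Phi> y" if "0 \<le> y" for y
  proof -
    have "has_bochner_integral lborel (\<lambda>x. exp (- x\<^sup>2) * indicator {0..y} x) (F y - F 0)"
      by (intro has_bochner_integral_FTC_Icc_nonneg) (auto intro!: F that continuous_intros)
    moreover have "(\<lambda>x. indicator {..y} x *\<^sub>R (indicator {0..} x *\<^sub>R exp (- x\<^sup>2))) = (\<lambda>x. exp (- x\<^sup>2) * indicator {0..y} x)"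
      by (auto split: split_indicator)
    ultimately show ?thesis
      by (simp add: has_bochner_integral_iff \<Phi>_def)
  qed
  have top: "(\<Phi> \<longlongrightarrow> sqrt pi / 2) at_top"
    by (rule Lim_transform_eventually[OF lim]) (rule eventually_mono[OF eventually_ge_at_top[of 0]], rule eq)
  \<comment> \<open>\<open>\<Phi>\<close> is normalised to vanish at 0, hence odd, and its limit at
    minus infinity follows from the one at plus infinity.\<close>
  have "((\<lambda>y. \<Phi> (- y) + \<Phi> y) has_real_derivative 0) (at y)" for y
    by (rule derivative_eq_intros DERIV_chain2[OF D] D refl | simp)+
  then have "\<Phi> (- y) + \<Phi> y = \<Phi> (-0) + \<Phi> 0" for y
    using DERIV_isconst_all[of "\<lambda>y. \<Phi> (- y) + \<Phi> y" y 0] by blast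
  moreover have "\<Phi> 0 = 0" by (simp add: \<Phi>_def)
  ultimately have odd: "\<Phi> (- y) = - \<Phi> y" for y
    by (simp add: eq_neg_iff_add_eq_0)
  have "((\<lambda>y. \<Phi> (- y)) \<longlongrightarrow> - (sqrt pi / 2)) at_top"
    unfolding odd by (intro tendsto_intros top)
  then have "(\<Phi> \<longlongrightarrow> - (sqrt pi / 2)) at_bot"
    by (simp add: filterlim_at_bot_mirror)
  with D top that show thesis by (metis minus_divide_left)
qed

text \<open>Subordination formula: \<open>exp (- 2 * s)\<close> is a mixture of Gaussians in
  \<open>s\<close>. The case \<open>s = 0\<close> is separate because \<open>m - s/m\<close> then no
  longer tends to minus infinity as \<open>m\<close> tends to 0.\<close>

lemma nn_integral_exp_gauss_mixture:
  fixes s :: real assumes "0 \<le> s"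
  shows "(\<integral>\<^sup>+m. ennreal (exp (- m\<^sup>2 - s\<^sup>2 / m\<^sup>2)) * indicator {0<..} m \<partial>lborel)
    = ennreal (sqrt pi / 2 * exp (- 2 * s))"
proof (cases "s = 0")
  case True
  have "(\<integral>\<^sup>+m. ennreal (exp (- m\<^sup>2 - s\<^sup>2 / m\<^sup>2)) * indicator {0<..} m \<partial>lborel)
    = (\<integral>\<^sup>+m. ennreal (indicator {0..} m *\<^sub>R exp (- m\<^sup>2)) \<partial>lborel)"
    by (rule nn_integral_cong_AE) (use True in \<open>auto split: split_indicator intro!: AE_I[where N="{0}"]\<close>)
  also have "\<dots> = ennreal (sqrt pi / 2)"
    using gaussian_moment_0 by (auto simp: has_bochner_integral_iff nn_integral_eq_integral)
  finally show ?thesis using True by simp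
next
  case False
  with assms have s: "0 < s" by simp
  obtain \<Phi> where D: "\<And>y. (\<Phi> has_real_derivative exp (- y\<^sup>2)) (at y)"
    and top: "(\<Phi> \<longlongrightarrow> sqrt pi / 2) at_top" and bot: "(\<Phi> \<longlongrightarrow> - sqrt pi / 2) at_bot"
    using gauss_antiderivative by blast
  \<comment> \<open>completing the square in two ways yields an explicit antiderivative of the integrand\<close>
  define F where "F m = (exp (2 * s) * \<Phi> (m + s/m) + exp (- 2 * s) * \<Phi> (m - s/m)) / 2" for m
  have e1: "exp (2 * s) * exp (- (m + s/m)\<^sup>2) = exp (- m\<^sup>2 - s\<^sup>2/m\<^sup>2)"
   and e2: "exp (- 2 * s) * exp (- (m - s/m)\<^sup>2) = exp (- m\<^sup>2 - s\<^sup>2/m\<^sup>2)" if "m > 0" for m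
    using that by (auto simp: exp_add[symmetric] power2_eq_square field_simps)
  have DF: "(F has_real_derivative exp (- m\<^sup>2 - s\<^sup>2/m\<^sup>2)) (at m)" if m: "m > 0" for m
  proof -
    have "(F has_real_derivative ((exp (2 * s) * exp (- (m + s/m)\<^sup>2)) * (1 - s/m\<^sup>2) + (exp (- 2 * s) * exp (- (m - s/m)\<^sup>2)) * (1 + s/m\<^sup>2)) / 2) (at m)"
      unfolding F_def using m
      by (auto intro!: derivative_eq_intros DERIV_chain2[OF D] simp: power2_eq_square field_simps)
    then show ?thesis unfolding e1[OF m] e2[OF m] by (simp add: field_simps)
  qed
  \<comment> \<open>At 0 the two arguments diverge with opposite signs, at infinity with the same
    sign. In the difference of the limits of \<open>F\<close> the \<open>exp (2 * s)\<close> terms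
    cancel.\<close>
  have t: "filterlim (\<lambda>m. m + s/m) at_top (at_right 0)" "filterlim (\<lambda>m. m + s/m) at_top at_top"
     "filterlim (\<lambda>m. m - s/m) at_bot (at_right 0)" "filterlim (\<lambda>m. m - s/m) at_top at_top"
    using s by real_asymp+
  have L0: "(F \<longlongrightarrow> (exp (2 * s) * (sqrt pi / 2) + exp (- 2 * s) * (- sqrt pi / 2)) / 2) (at_right 0)"
    unfolding F_def by (intro tendsto_intros filterlim_compose[OF top] filterlim_compose[OF bot] t) auto
  have L1: "(F \<longlongrightarrow> (exp (2 * s) * (sqrt pi / 2) + exp (- 2 * s) * (sqrt pi / 2)) / 2) at_top"
    unfolding F_def by (intro tendsto_intros filterlim_compose[OF top] filterlim_compose[OF bot] t) auto
  have a: "((F \<circ> real_of_ereal) \<longlongrightarrow> (exp (2 * s) * (sqrt pi / 2) + exp (- 2 * s) * (- sqrt pi / 2)) / 2) (at_right 0)"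
    "((F \<circ> real_of_ereal) \<longlongrightarrow> (exp (2 * s) * (sqrt pi / 2) + exp (- 2 * s) * (sqrt pi / 2)) / 2) (at_left \<infinity>)"
    using L0 L1 by (simp_all add: ereal_tendsto_simps zero_ereal_def)
  have c: "isCont (\<lambda>m. exp (- m\<^sup>2 - s\<^sup>2/m\<^sup>2)) m" if "m > 0" for m
    using that by (intro continuous_intros) auto
  note FTC = interval_integral_FTC_nonneg[of 0 "\<infinity>" F "\<lambda>m. exp (- m\<^sup>2 - s\<^sup>2/m\<^sup>2)", OF _ DF c _ a]
  have "set_integrable lborel (einterval 0 \<infinity>) (\<lambda>m. exp (- m\<^sup>2 - s\<^sup>2/m\<^sup>2))"
    by (rule FTC(1)) auto
  then have I: "integrable lborel (\<lambda>m. indicator {0<..} m *\<^sub>R exp (- m\<^sup>2 - s\<^sup>2/m\<^sup>2))"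
    by (simp add: set_integrable_def einterval_def greaterThan_def)
  have "(LBINT m=0..\<infinity>. exp (- m\<^sup>2 - s\<^sup>2/m\<^sup>2)) = sqrt pi / 2 * exp (- 2 * s)"
    by (subst FTC(2)) (auto simp: field_simps)
  then have V: "(\<integral>m. indicator {0<..} m *\<^sub>R exp (- m\<^sup>2 - s\<^sup>2/m\<^sup>2) \<partial>lborel) = sqrt pi / 2 * exp (- 2 * s)"
    by (simp add: interval_lebesgue_integral_def set_lebesgue_integral_def einterval_def greaterThan_def)
  have "(\<integral>\<^sup>+m. ennreal (exp (- m\<^sup>2 - s\<^sup>2 / m\<^sup>2)) * indicator {0<..} m \<partial>lborel)
    = (\<integral>\<^sup>+m. ennreal (indicator {0<..} m *\<^sub>R exp (- m\<^sup>2 - s\<^sup>2/m\<^sup>2)) \<partial>lborel)"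
    by (rule nn_integral_cong) (auto split: split_indicator)
  also have "\<dots> = ennreal (\<integral>m. indicator {0<..} m *\<^sub>R exp (- m\<^sup>2 - s\<^sup>2/m\<^sup>2) \<partial>lborel)"
    by (rule nn_integral_eq_integral[OF I]) auto
  finally show ?thesis unfolding V .
qed

section \<open>Uniqueness and rotation invariance of Lebesgue measure\<close>

text \<open>
  Computing the double integral of \<open>indicator A x * indicator B (y - x)\<close> against \<open>M\<close> and Lebesgue
  measure in both orders, where \<open>B\<close> is the unit ball, compares the two measures on \<open>A\<close>.
\<close>

lemma lborel_uniqueI:
  fixes M :: "'a::euclidean_space measure"
  assumes [measurable_cong]: "sets M = sets borel"
    and trans: "\<And>c. distr M borel ((+) c) = M"
    and "sigma_finite_measure M"
    and ball: "emeasure M (ball 0 1) = emeasure lborel (ball (0::'a) 1)"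
  shows "M = lborel"
proof (rule measure_eqI)
  fix A assume "A \<in> sets M"
  then have A[measurable]: "A \<in> sets borel" using assms(1) by simp
  let ?B = "ball (0::'a) 1"
  have [measurable]: "?B \<in> sets borel" by simp
  interpret M: sigma_finite_measure M by fact
  interpret P: pair_sigma_finite M lborel ..
  have trl: "(\<integral>\<^sup>+y. f (c + y) \<partial>lborel) = (\<integral>\<^sup>+y. f y \<partial>lborel)"
    if "f \<in> borel_measurable borel" for f :: "'a \<Rightarrow> ennreal" and c
    by (subst (2) lborel_distr_plus[of c, symmetric]) (simp add: nn_integral_distr that)
  have trM: "(\<integral>\<^sup>+y. f (c + y) \<partial>M) = (\<integral>\<^sup>+y. f y \<partial>M)"
    if "f \<in> borel_measurable borel" for f :: "'a \<Rightarrow> ennreal" and c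
    by (subst (2) trans[of c, symmetric]) (simp add: nn_integral_distr that)
  have "emeasure M A * emeasure lborel ?B
      = (\<integral>\<^sup>+x. indicator A x * emeasure lborel ?B \<partial>M)"
    by (simp add: nn_integral_multc)
  also have "\<dots> = (\<integral>\<^sup>+x. \<integral>\<^sup>+y. indicator A x * indicator ?B (y - x) \<partial>lborel \<partial>M)"
  proof (rule nn_integral_cong)
    fix x
    have m: "(\<lambda>y. indicator ?B (y - x) :: ennreal) \<in> borel_measurable lborel" by measurable
    have "(\<integral>\<^sup>+y. indicator ?B (y - x) \<partial>lborel) = (\<integral>\<^sup>+y. indicator ?B y \<partial>(lborel :: 'a measure) :: ennreal)"
      using trl[of "indicator ?B" "- x", OF borel_measurable_indicator] by simp
    then show "indicator A x * emeasure lborel ?B = (\<integral>\<^sup>+y. indicator A x * indicator ?B (y - x) \<partial>lborel)"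
      by (simp add: nn_integral_cmult[OF m])
  qed
  also have "\<dots> = (\<integral>\<^sup>+y. \<integral>\<^sup>+x. indicator A x * indicator ?B (y - x) \<partial>M \<partial>lborel)"
    by (rule P.Fubini'[symmetric]) measurable
  also have "\<dots> = (\<integral>\<^sup>+y. \<integral>\<^sup>+x. indicator A (y + x) * indicator ?B x \<partial>M \<partial>lborel)"
  proof (rule nn_integral_cong)
    fix y
    have "(\<integral>\<^sup>+x. indicator A (y + x) * indicator ?B (y - (y + x)) \<partial>M) = (\<integral>\<^sup>+x. indicator A x * indicator ?B (y - x) \<partial>M)"
      by (rule trM) measurable
    then show "(\<integral>\<^sup>+x. indicator A x * indicator ?B (y - x) \<partial>M) = (\<integral>\<^sup>+x. indicator A (y + x) * indicator ?B x \<partial>M)"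
      by (simp add: indicator_def)
  qed
  also have "\<dots> = (\<integral>\<^sup>+x. \<integral>\<^sup>+y. indicator A (y + x) * indicator ?B x \<partial>lborel \<partial>M)"
    by (rule P.Fubini') measurable
  also have "\<dots> = (\<integral>\<^sup>+x. emeasure lborel A * indicator ?B x \<partial>M)"
  proof (rule nn_integral_cong)
    fix x
    have "(\<integral>\<^sup>+y. indicator A (y + x) \<partial>lborel) = (\<integral>\<^sup>+y. indicator A y \<partial>lborel :: ennreal)"
      using trl[of "indicator A" x] by (simp add: add.commute)
    then show "(\<integral>\<^sup>+y. indicator A (y + x) * indicator ?B x \<partial>lborel) = emeasure lborel A * indicator ?B x"
      by (simp add: nn_integral_multc)
  qed
  also have "\<dots> = emeasure lborel A * emeasure M ?B"
    by (simp add: nn_integral_cmult)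
  finally have "emeasure M A * emeasure lborel ?B = emeasure lborel A * emeasure lborel ?B"
    by (simp add: ball)
  moreover have "emeasure lborel ?B \<noteq> 0" "emeasure lborel ?B \<noteq> \<infinity>"
    using emeasure_lborel_ball_finite[of "0::'a" 1] less_imp_neq[OF unit_ball_vol_pos[of "real DIM('a)"]]
    by (auto simp: emeasure_ball)
  ultimately show "emeasure M A = emeasure lborel A"
    by (simp add: ennreal_mult_cancel_left mult.commute[of _ "emeasure lborel ?B"])
qed (simp add: assms(1))

text \<open>The image measure is translation invariant, as a shift by \<open>T e\<close> pulls back
  to the shift by \<open>e\<close>, and it gives balls around 0 their usual volume because
  \<open>T\<close> preserves norms. Uniqueness of Lebesgue measure does the rest.\<close>

lemma lborel_distr_orthogonal_transformation:
  fixes T :: "'a::euclidean_space \<Rightarrow> 'a"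
  assumes T: "orthogonal_transformation T"
  shows "distr lborel borel T = lborel"
proof (rule lborel_uniqueI)
  have lin: "linear T" using T by (rule orthogonal_transformation_linear)
  have [measurable]: "T \<in> borel_measurable borel"
    using lin by (intro borel_measurable_continuous_onI linear_continuous_on) (simp add: linear_conv_bounded_linear)
  have b: "emeasure (distr lborel borel T) (ball 0 r) = emeasure lborel (ball (0::'a) r)" for r
    using T by (simp add: emeasure_distr) (simp add: vimage_def orthogonal_transformation ball_def dist_norm)
  show "emeasure (distr lborel borel T) (ball 0 1) = emeasure lborel (ball (0::'a) 1)" by (rule b)
  show "sigma_finite_measure (distr lborel borel T)"
  proof
    show "\<exists>S. countable S \<and> S \<subseteq> sets (distr lborel borel T) \<and> \<Union> S = space (distr lborel borel T) \<and> (\<forall>a\<in>S. emeasure (distr lborel borel T) a \<noteq> \<infinity>)"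
      using emeasure_lborel_ball_finite[of "0::'a"]
      by (intro exI[of _ "range (\<lambda>n::nat. ball 0 (real n))"]) (auto simp: b reals_Archimedean2 less_top[symmetric])
  qed
  fix c
  obtain e where e: "T e = c" using orthogonal_transformation_surj[OF T] by (metis surj_def)
  have "distr (distr lborel borel T) borel ((+) c) = distr lborel borel (\<lambda>z. T (e + z))"
    by (subst distr_distr) (auto simp: o_def e linear_add[OF lin])
  also have "\<dots> = distr (distr lborel borel ((+) e)) borel T"
    by (subst distr_distr) (auto simp: o_def)
  finally show "distr (distr lborel borel T) borel ((+) c) = distr lborel borel T"
    by (simp only: lborel_distr_plus)
qed simp

section \<open>Reduction of Gaussian integrals in space to the line\<close>

lemma nn_integral_gauss:
  assumes "0 < m"
  shows "(\<integral>\<^sup>+s. ennreal (exp (- s\<^sup>2 / m\<^sup>2)) \<partial>lborel) = ennreal (sqrt pi * m)"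
proof -
  \<comment> \<open>The standard deviation for which the normal density has exponent
    \<open>- s\<^sup>2 / m\<^sup>2\<close>.\<close>
  have s: "0 < m / sqrt 2" using assms by simp
  interpret prob_space "density lborel (normal_density 0 (m / sqrt 2))"
    using s by (rule prob_space_normal_density)
  have "exp (- s\<^sup>2 / m\<^sup>2) = sqrt pi * m * normal_density 0 (m / sqrt 2) s" for s
    using assms by (simp add: normal_density_def power_divide real_sqrt_mult)
  then have "(\<integral>\<^sup>+s. ennreal (exp (- s\<^sup>2 / m\<^sup>2)) \<partial>lborel)
      = ennreal (sqrt pi * m) * (\<integral>\<^sup>+s. ennreal (normal_density 0 (m / sqrt 2) s) \<partial>lborel)"
    using assms by (simp add: ennreal_mult' nn_integral_cmult)
  also have "(\<integral>\<^sup>+s. ennreal (normal_density 0 (m / sqrt 2) s) \<partial>lborel) = 1"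
    using emeasure_space_1 by (simp add: emeasure_density)
  finally show ?thesis by simp
qed

text \<open>Rotate \<open>x\<close> onto a coordinate axis. The other coordinates add the same
  amount to both squared norms, so they leave the maximum and split off as one-dimensional Gaussian
  factors \<open>sqrt pi * m\<close>.\<close>

lemma nn_integral_gauss_max:
  fixes x :: "real ^ 'n"
  assumes m: "0 < m"
  shows "(\<integral>\<^sup>+z. ennreal (exp (- max ((norm z)\<^sup>2) ((norm (z - x))\<^sup>2) / m\<^sup>2)) \<partial>lborel)
    = ennreal ((sqrt pi * m) ^ (CARD('n) - 1)) *
      (\<integral>\<^sup>+s. ennreal (exp (- max (s\<^sup>2) ((s - norm x)\<^sup>2) / m\<^sup>2)) \<partial>lborel)"
proof -
  obtain k :: 'n where True by simp
  define b where "b = (axis k 1 :: real ^ 'n)"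
  have b: "b \<in> Basis" by (simp add: b_def axis_in_Basis_iff)
  obtain T where T: "orthogonal_transformation T" "T (norm x *\<^sub>R b) = x"
    using orthogonal_transformation_exists[of "norm x *\<^sub>R b" x] b by auto
  have lin: "linear T" using T(1) by (rule orthogonal_transformation_linear)
  have [measurable]: "T \<in> borel_measurable borel"
    using lin by (intro borel_measurable_continuous_onI linear_continuous_on) (simp add: linear_conv_bounded_linear)
  define g where "g b' s = (if b' = b then exp (- max (s\<^sup>2) ((s - norm x)\<^sup>2) / m\<^sup>2) else exp (- s\<^sup>2 / m\<^sup>2))"
    for b' :: "real ^ 'n" and s :: real
  have g: "exp (- max ((norm (T z))\<^sup>2) ((norm (T z - x))\<^sup>2) / m\<^sup>2) = (\<Prod>b'\<in>Basis. g b' (z \<bullet> b'))" for z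
  proof -
    define R where "R = (\<Sum>b'\<in>Basis - {b}. (z \<bullet> b')\<^sup>2)"
    have "T z - x = T (z - norm x *\<^sub>R b)" by (simp add: linear_diff[OF lin] T(2))
    then have n: "norm (T z - x) = norm (z - norm x *\<^sub>R b)" "norm (T z) = norm z"
      using T(1) by (simp_all add: orthogonal_transformation)
    have sq: "(norm y)\<^sup>2 = (y \<bullet> b)\<^sup>2 + (\<Sum>b'\<in>Basis - {b}. (y \<bullet> b')\<^sup>2)" for y :: "real ^ 'n"
      unfolding power2_norm_eq_inner[of y] euclidean_inner[of y y]
      by (subst sum.remove[OF _ b]) (simp_all add: power2_eq_square)
    have "(norm (z - norm x *\<^sub>R b))\<^sup>2 = (z \<bullet> b - norm x)\<^sup>2 + R"
      unfolding sq R_def using b by (auto simp: inner_diff_left inner_Basis intro!: sum.cong split: if_splits)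
    moreover have "(norm z)\<^sup>2 = (z \<bullet> b)\<^sup>2 + R" unfolding sq R_def ..
    ultimately have "max ((norm (T z))\<^sup>2) ((norm (T z - x))\<^sup>2) = max ((z \<bullet> b)\<^sup>2) ((z \<bullet> b - norm x)\<^sup>2) + R"
      unfolding n by (simp add: max_def)
    moreover have "(\<Prod>b'\<in>Basis. g b' (z \<bullet> b')) = g b (z \<bullet> b) * (\<Prod>b'\<in>Basis - {b}. exp (- (z \<bullet> b')\<^sup>2 / m\<^sup>2))"
      using b by (subst prod.remove[OF _ b]) (auto simp: g_def intro!: prod.cong)
    moreover have "(\<Prod>b'\<in>Basis - {b}. exp (- (z \<bullet> b')\<^sup>2 / m\<^sup>2)) = exp (- R / m\<^sup>2)"
      by (simp add: exp_sum[symmetric] R_def sum_negf sum_divide_distrib)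
    ultimately show ?thesis
      by (simp add: g_def exp_add[symmetric] diff_divide_distrib)
  qed
  have "(\<integral>\<^sup>+z. ennreal (exp (- max ((norm z)\<^sup>2) ((norm (z - x))\<^sup>2) / m\<^sup>2)) \<partial>lborel)
      = (\<integral>\<^sup>+z. ennreal (exp (- max ((norm (T z))\<^sup>2) ((norm (T z - x))\<^sup>2) / m\<^sup>2)) \<partial>lborel)"
    by (subst lborel_distr_orthogonal_transformation[OF T(1), symmetric]) (simp add: nn_integral_distr)
  also have "\<dots> = (\<integral>\<^sup>+z. (\<Prod>b'\<in>Basis. ennreal (g b' (z \<bullet> b'))) \<partial>lborel)"
    unfolding g by (subst prod_ennreal) (auto simp: g_def)
  also have "\<dots> = (\<Prod>b'\<in>Basis. \<integral>\<^sup>+s. ennreal (g b' s) \<partial>lborel)"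
    by (rule nn_integral_lborel_prod) (auto simp: g_def)
  also have "\<dots> = (\<integral>\<^sup>+s. ennreal (g b s) \<partial>lborel) * (\<Prod>b'\<in>Basis - {b}. ennreal (sqrt pi * m))"
    using b m by (subst prod.remove[OF _ b]) (auto simp: g_def nn_integral_gauss[OF m, simplified] intro!: prod.cong)
  also have "(\<Prod>b'\<in>Basis - {b}. ennreal (sqrt pi * m)) = ennreal ((sqrt pi * m) ^ (CARD('n) - 1))"
    using b m by (simp add: ennreal_power)
  finally show ?thesis by (simp add: g_def mult.commute)
qed

lemma nn_integral_exp_abs: "(\<integral>\<^sup>+u. ennreal (exp (- 2 * \<bar>u\<bar>)) \<partial>lborel) = 1"
proof -
  have h: "(\<integral>\<^sup>+u. ennreal (exp (- 2 * u)) * indicator {0..} u \<partial>lborel) = ennreal (0 - (- exp (- 2 * 0) / 2))"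
    by (rule nn_integral_FTC_atLeast) (auto intro!: derivative_eq_intros, real_asymp)
  have "(\<integral>\<^sup>+u. ennreal (exp (2 * u)) * indicator {..0} u \<partial>lborel) = (\<integral>\<^sup>+u. ennreal (exp (- 2 * u)) * indicator {0..} u \<partial>lborel)"
    by (subst nn_integral_real_affine[of _ "-1" 0]) (auto simp: indicator_def intro!: nn_integral_cong)
  moreover have "(\<integral>\<^sup>+u. ennreal (exp (- 2 * \<bar>u\<bar>)) \<partial>lborel)
    = (\<integral>\<^sup>+u. ennreal (exp (- 2 * u)) * indicator {0..} u + ennreal (exp (2 * u)) * indicator {..0} u \<partial>lborel)"
    by (rule nn_integral_cong_AE) (auto intro!: AE_I[where N="{0}"] split: split_indicator)
  moreover have "inverse 2 + inverse 2 = (1::ennreal)"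
    using ennreal_divide_self[of 2] by (simp add: divide_ennreal_def mult_2)
  ultimately show ?thesis
    using h by (simp add: nn_integral_add)
qed

text \<open>The divisor \<open>(sqrt pi * m) ^ (CARD('n) - 1)\<close> cancels the factors from the
  directions orthogonal to \<open>y - x\<close>. On the remaining line, integrating over
  \<open>m\<close> first turns the Gaussians into
  \<open>exp (- 2 * max \<bar>s\<bar> \<bar>s - d\<bar>)\<close> with
  \<open>d = norm (y - x)\<close>.\<close>

lemma exp_dist_gauss_mixture:
  fixes x y :: "real ^ 'n"
  shows "(\<integral>\<^sup>+m. \<integral>\<^sup>+z. ennreal (indicator {0<..} m * exp (- m\<^sup>2) / (sqrt pi * m) ^ (CARD('n) - 1)
       * exp (- max ((norm (z - x))\<^sup>2) ((norm (z - y))\<^sup>2) / m\<^sup>2)) \<partial>lborel \<partial>lborel)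
     = ennreal (sqrt pi / 2 * exp (- dist x y))"
proof -
  let ?d = "norm (y - x)"
  let ?J = "\<lambda>m. (\<integral>\<^sup>+s. ennreal (exp (- max (s\<^sup>2) ((s - ?d)\<^sup>2) / m\<^sup>2)) \<partial>lborel)"
  have inner: "(\<integral>\<^sup>+z. ennreal (indicator {0<..} m * exp (- m\<^sup>2) / (sqrt pi * m) ^ (CARD('n) - 1)
       * exp (- max ((norm (z - x))\<^sup>2) ((norm (z - y))\<^sup>2) / m\<^sup>2)) \<partial>lborel)
     = (\<integral>\<^sup>+s. ennreal (exp (- m\<^sup>2 - (max \<bar>s\<bar> \<bar>s - ?d\<bar>)\<^sup>2 / m\<^sup>2)) * indicator {0<..} m \<partial>lborel)" for m
  proof (cases "0 < m")
    case m: True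
    let ?c = "(sqrt pi * m) ^ (CARD('n) - 1)"
    have c: "0 < ?c" using m by simp
    have "(\<integral>\<^sup>+z. ennreal (exp (- max ((norm (z - x))\<^sup>2) ((norm (z - y))\<^sup>2) / m\<^sup>2)) \<partial>lborel)
       = (\<integral>\<^sup>+z. ennreal (exp (- max ((norm z)\<^sup>2) ((norm (z - (y - x)))\<^sup>2) / m\<^sup>2)) \<partial>lborel)"
      by (subst lborel_distr_plus[of "x", symmetric]) (simp add: nn_integral_distr algebra_simps)
    also have "\<dots> = ennreal ?c * ?J m" by (rule nn_integral_gauss_max[OF m])
    finally have 1: "(\<integral>\<^sup>+z. ennreal (exp (- max ((norm (z - x))\<^sup>2) ((norm (z - y))\<^sup>2) / m\<^sup>2)) \<partial>lborel) = ennreal ?c * ?J m" .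
    have sq: "(max \<bar>s\<bar> \<bar>s - ?d\<bar>)\<^sup>2 = max (s\<^sup>2) ((s - ?d)\<^sup>2)" for s
      by (auto simp: max_def abs_le_square_iff)
    have "ennreal (indicator {0<..} m * exp (- m\<^sup>2) / ?c * e) = ennreal (exp (- m\<^sup>2) / ?c) * ennreal e" if "0 \<le> e" for e
      using m c that by (simp add: ennreal_mult[symmetric])
    then have "(\<integral>\<^sup>+z. ennreal (indicator {0<..} m * exp (- m\<^sup>2) / ?c
       * exp (- max ((norm (z - x))\<^sup>2) ((norm (z - y))\<^sup>2) / m\<^sup>2)) \<partial>lborel)
      = ennreal (exp (- m\<^sup>2) / ?c) * (ennreal ?c * ?J m)"
      unfolding 1[symmetric] by (simp add: nn_integral_cmult)
    also have "\<dots> = ennreal (exp (- m\<^sup>2)) * ?J m"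
      using m c by (simp add: mult.assoc[symmetric] ennreal_mult[symmetric])
    also have "\<dots> = (\<integral>\<^sup>+s. ennreal (exp (- m\<^sup>2 - (max \<bar>s\<bar> \<bar>s - ?d\<bar>)\<^sup>2 / m\<^sup>2)) * indicator {0<..} m \<partial>lborel)"
      unfolding sq using m by (simp add: nn_integral_cmult[symmetric] ennreal_mult[symmetric] exp_add[symmetric])
    finally show ?thesis .
  qed simp
  have "(\<integral>\<^sup>+m. \<integral>\<^sup>+s. ennreal (exp (- m\<^sup>2 - (max \<bar>s\<bar> \<bar>s - ?d\<bar>)\<^sup>2 / m\<^sup>2)) * indicator {0<..} m \<partial>lborel \<partial>lborel)
     = (\<integral>\<^sup>+s. \<integral>\<^sup>+m. ennreal (exp (- m\<^sup>2 - (max \<bar>s\<bar> \<bar>s - ?d\<bar>)\<^sup>2 / m\<^sup>2)) * indicator {0<..} m \<partial>lborel \<partial>lborel)"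
    by (rule lborel_pair.Fubini') measurable
  also have "\<dots> = (\<integral>\<^sup>+s. ennreal (sqrt pi / 2) * ennreal (exp (- 2 * max \<bar>s\<bar> \<bar>s - ?d\<bar>)) \<partial>lborel)"
    by (intro nn_integral_cong, subst nn_integral_exp_gauss_mixture) (auto simp: ennreal_mult[symmetric])
  also have "\<dots> = ennreal (sqrt pi / 2) * (\<integral>\<^sup>+s. ennreal (exp (- 2 * max \<bar>s\<bar> \<bar>s - ?d\<bar>)) \<partial>lborel)"
    by (simp add: nn_integral_cmult)
  \<comment> \<open>Recentred at the midpoint of the segment, twice the maximum becomes
    \<open>d + 2 * \<bar>s\<bar>\<close>, so the factor \<open>exp (- d)\<close> separates.\<close>
  also have "(\<integral>\<^sup>+s. ennreal (exp (- 2 * max \<bar>s\<bar> \<bar>s - ?d\<bar>)) \<partial>lborel)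
      = (\<integral>\<^sup>+s. ennreal (exp (- 2 * max \<bar>?d/2 + s\<bar> \<bar>?d/2 + s - ?d\<bar>)) \<partial>lborel)"
    by (subst lborel_distr_plus[of "?d/2", symmetric]) (simp add: nn_integral_distr)
  also have "\<dots> = (\<integral>\<^sup>+s. ennreal (exp (- ?d)) * ennreal (exp (- 2 * \<bar>s\<bar>)) \<partial>lborel)"
  proof (rule nn_integral_cong)
    fix s
    have "2 * max \<bar>d/2 + s\<bar> \<bar>d/2 + s - d\<bar> = d + 2 * \<bar>s\<bar>" if "0 \<le> d" for d :: real
      using that by (auto simp: max_def abs_if field_simps)
    from this[of ?d] have "2 * max \<bar>?d/2 + s\<bar> \<bar>?d/2 + s - ?d\<bar> = ?d + 2 * \<bar>s\<bar>" by simp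
    then show "ennreal (exp (- 2 * max \<bar>?d/2 + s\<bar> \<bar>?d/2 + s - ?d\<bar>)) = ennreal (exp (- ?d)) * ennreal (exp (- 2 * \<bar>s\<bar>))"
      by (simp add: ennreal_mult[symmetric] exp_add[symmetric])
  qed
  also have "\<dots> = ennreal (exp (- ?d))"
    by (subst nn_integral_cmult) (auto simp: nn_integral_exp_abs[simplified])
  finally show ?thesis
    unfolding inner by (simp add: ennreal_mult[symmetric] dist_norm norm_minus_commute)
qed

section \<open>The translation invariant measure on the space of balls\<close>

text \<open>A point \<open>(v, z)\<close> stands for the ball with centre \<open>z\<close> and radius \<open>sqrt v\<close>.\<close>

definition ball_cone :: "'a::euclidean_space \<Rightarrow> (real \<times> 'a) set" where
  "ball_cone x = {(v, z). (norm (z - x))\<^sup>2 \<le> v}"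

lemma ball_cone_measurable [measurable]: "ball_cone x \<in> sets borel"
proof -
  have "closed {p :: real \<times> 'a. (norm (snd p - x))\<^sup>2 \<le> fst p}"
    by (intro closed_Collect_le continuous_intros)
  also have "{p. (norm (snd p - x))\<^sup>2 \<le> fst p} = ball_cone x" by (auto simp: ball_cone_def)
  finally show ?thesis by (rule borel_closed)
qed

text \<open>An exponential tail replaces the Gaussian by an integral over squared radii
  \<open>v\<close>. When \<open>M\<close> is a maximum of two squared distances, the condition
  \<open>M \<le> v\<close> says that both points lie in the ball.\<close>

lemma exp_eq_nn_integral:
  assumes "0 < m"
  shows "ennreal (exp (- M / m\<^sup>2)) = (\<integral>\<^sup>+v. ennreal (inverse (m\<^sup>2) * exp (- v / m\<^sup>2)) * (if M \<le> v then 1 else 0) \<partial>lborel)"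
proof -
  have "(\<integral>\<^sup>+v. ennreal (inverse (m\<^sup>2) * exp (- v / m\<^sup>2)) * indicator {M..} v \<partial>lborel)
    = ennreal (0 - (- exp (- M / m\<^sup>2)))"
    by (rule nn_integral_FTC_atLeast) (use assms in \<open>auto intro!: derivative_eq_intros simp: divide_inverse\<close>, real_asymp)
  then show ?thesis by (simp add: indicator_def of_bool_def)
qed

text \<open>The exponential densities of the previous lemma, mixed over \<open>m\<close> with the
  weight of \<open>exp_dist_gauss_mixture\<close>; \<open>2 / sqrt pi\<close> normalises that
  mixture. Dependence on \<open>v\<close> alone makes the measure translation invariant. Values are
  in \<open>ennreal\<close> because the integral diverges for \<open>v \<le> 0\<close>; cones have
  finite measure nonetheless.\<close>

definition radial_density :: "'n itself \<Rightarrow> real \<Rightarrow> ennreal" where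
  "radial_density _ v = (\<integral>\<^sup>+m. ennreal (2 / sqrt pi * (indicator {0<..} m * exp (- m\<^sup>2) / (sqrt pi * m) ^ (CARD('n) - 1))
     * (inverse (m\<^sup>2) * exp (- v / m\<^sup>2))) \<partial>lborel)"

definition ball_measure :: "'n itself \<Rightarrow> (real \<times> (real ^ 'n)) measure" where
  "ball_measure t = density lborel (\<lambda>(v, z). radial_density t v)"

lemma measurable_radial_density [measurable]: "radial_density t \<in> borel_measurable borel"
  unfolding radial_density_def by measurable

lemma sets_ball_measure [measurable_cong, simp]: "sets (ball_measure t) = sets borel"
  by (simp add: ball_measure_def)

lemma emeasure_ball_measure:
  assumes [measurable]: "A \<in> sets borel"
  shows "emeasure (ball_measure TYPE('n::finite)) A =
    (\<integral>\<^sup>+v. \<integral>\<^sup>+z. radial_density TYPE('n::finite) v * indicator A (v, z) \<partial>lborel \<partial>lborel)"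
proof -
  have [measurable]: "(fst :: real \<times> (real ^ 'n) \<Rightarrow> real) \<in> borel_measurable borel"
    by (intro borel_measurable_continuous_onI continuous_intros)
  have "emeasure (ball_measure TYPE('n::finite)) A
    = (\<integral>\<^sup>+p. radial_density TYPE('n::finite) (fst p) * indicator A p \<partial>(lborel \<Otimes>\<^sub>M lborel))"
    unfolding ball_measure_def by (subst emeasure_density) (auto simp: lborel_prod case_prod_unfold)
  also have "\<dots> = (\<integral>\<^sup>+v. \<integral>\<^sup>+z. radial_density TYPE('n::finite) v * indicator A (v, z) \<partial>lborel \<partial>lborel)"
    by (subst lborel.nn_integral_fst[symmetric]) (auto simp: lborel_prod)
  finally show ?thesis .
qed

text \<open>A ball contains both points iff its squared radius is at least the larger squared
  distance from its centre. Integrating over \<open>v\<close> first therefore leaves the Gaussian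
  mixture already computed. The case \<open>x = y\<close> shows that each cone has measure
  1.\<close>

lemma emeasure_ball_cone_inter:
  "emeasure (ball_measure TYPE('n::finite)) (ball_cone x \<inter> ball_cone y) = ennreal (exp (- dist x y))"
proof -
  let ?N = "CARD('n) - 1"
  let ?M = "\<lambda>z. max ((norm (z - x))\<^sup>2) ((norm (z - y))\<^sup>2)"
  let ?w = "\<lambda>m::real. indicator {0<..} m * exp (- m\<^sup>2) / (sqrt pi * m) ^ ?N"
  have w: "0 \<le> ?w m" for m by (auto simp: indicator_def)
  have ind: "indicator (ball_cone x \<inter> ball_cone y) (v, z) = (if ?M z \<le> v then 1 else 0 :: ennreal)" for v z
    by (auto simp: ball_cone_def indicator_def)
  have "emeasure (ball_measure TYPE('n::finite)) (ball_cone x \<inter> ball_cone y)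
    = (\<integral>\<^sup>+v. \<integral>\<^sup>+z. \<integral>\<^sup>+m. ennreal (2 / sqrt pi * ?w m * (inverse (m\<^sup>2) * exp (- v / m\<^sup>2))) * (if ?M z \<le> v then 1 else 0) \<partial>lborel \<partial>lborel \<partial>lborel)"
    unfolding emeasure_ball_measure[OF sets.Int[OF ball_cone_measurable ball_cone_measurable]] ind radial_density_def
    by (subst nn_integral_multc) (auto)
  also have "\<dots> = (\<integral>\<^sup>+z. \<integral>\<^sup>+v. \<integral>\<^sup>+m. ennreal (2 / sqrt pi * ?w m * (inverse (m\<^sup>2) * exp (- v / m\<^sup>2))) * (if ?M z \<le> v then 1 else 0) \<partial>lborel \<partial>lborel \<partial>lborel)"
    by (rule lborel_pair.Fubini'[symmetric]) measurable
  also have "\<dots> = (\<integral>\<^sup>+z. \<integral>\<^sup>+m. \<integral>\<^sup>+v. ennreal (2 / sqrt pi * ?w m * (inverse (m\<^sup>2) * exp (- v / m\<^sup>2))) * (if ?M z \<le> v then 1 else 0) \<partial>lborel \<partial>lborel \<partial>lborel)"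
    by (intro nn_integral_cong lborel_pair.Fubini'[symmetric]) measurable
  also have "\<dots> = (\<integral>\<^sup>+z. \<integral>\<^sup>+m. ennreal (2 / sqrt pi) * ennreal (?w m * exp (- ?M z / m\<^sup>2)) \<partial>lborel \<partial>lborel)"
  proof (intro nn_integral_cong)
    fix z :: "real ^ 'n" and m :: real
    show "(\<integral>\<^sup>+v. ennreal (2 / sqrt pi * ?w m * (inverse (m\<^sup>2) * exp (- v / m\<^sup>2))) * (if ?M z \<le> v then 1 else 0) \<partial>lborel)
      = ennreal (2 / sqrt pi) * ennreal (?w m * exp (- ?M z / m\<^sup>2))"
    proof (cases "0 < m")
      case True
      have w2: "0 \<le> 2 / sqrt pi * ?w m" using w[of m] by (intro mult_nonneg_nonneg) simp_all
      have "(\<integral>\<^sup>+v. ennreal (2 / sqrt pi * ?w m * (inverse (m\<^sup>2) * exp (- v / m\<^sup>2))) * (if ?M z \<le> v then 1 else 0) \<partial>lborel)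
        = (\<integral>\<^sup>+v. ennreal (2 / sqrt pi * ?w m) * (ennreal (inverse (m\<^sup>2) * exp (- v / m\<^sup>2)) * (if ?M z \<le> v then 1 else 0)) \<partial>lborel)"
        by (simp only: ennreal_mult'[OF w2]) (simp only: mult.assoc)
      also have "\<dots> = ennreal (2 / sqrt pi * ?w m) * ennreal (exp (- ?M z / m\<^sup>2))"
        unfolding exp_eq_nn_integral[OF True] by (rule nn_integral_cmult) measurable
      also have "\<dots> = ennreal (2 / sqrt pi) * ennreal (?w m * exp (- ?M z / m\<^sup>2))"
        using ennreal_mult'[of "2 / sqrt pi" "?w m"] by (simp only: ennreal_mult'[OF w[of m]] mult.assoc) (simp add: mult.assoc)
      finally show ?thesis .
    qed simp
  qed
  also have "\<dots> = ennreal (2 / sqrt pi) * (\<integral>\<^sup>+z. \<integral>\<^sup>+m. ennreal (?w m * exp (- ?M z / m\<^sup>2)) \<partial>lborel \<partial>lborel)"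
    by (subst nn_integral_cmult[symmetric], measurable) (intro nn_integral_cong nn_integral_cmult, measurable)
  also have "(\<integral>\<^sup>+z. \<integral>\<^sup>+m. ennreal (?w m * exp (- ?M z / m\<^sup>2)) \<partial>lborel \<partial>lborel)
     = (\<integral>\<^sup>+m. \<integral>\<^sup>+z. ennreal (?w m * exp (- ?M z / m\<^sup>2)) \<partial>lborel \<partial>lborel)"
    by (rule lborel_pair.Fubini') measurable
  also have "\<dots> = ennreal (sqrt pi / 2 * exp (- dist x y))"
    by (rule exp_dist_gauss_mixture)
  finally show ?thesis by (simp add: ennreal_mult[symmetric])
qed

lemma radial_density_pos: "0 < radial_density TYPE('n::finite) v"
proof -
  let ?f = "\<lambda>m::real. ennreal (2 / sqrt pi * (indicator {0<..} m * exp (- m\<^sup>2) / (sqrt pi * m) ^ (CARD('n) - 1))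
     * (inverse (m\<^sup>2) * exp (- v / m\<^sup>2)))"
  have "(\<integral>\<^sup>+m. ?f m \<partial>lborel) \<noteq> 0"
  proof
    assume "(\<integral>\<^sup>+m. ?f m \<partial>lborel) = 0"
    then have "AE m in lborel. ?f m = 0" by (subst (asm) nn_integral_0_iff_AE) auto
    moreover have "?f m \<noteq> 0" if "m \<in> {0<..<1}" for m
    proof -
      have "0 < m" using that by simp
      then have "0 < 2 / sqrt pi * (indicator {0<..} m * exp (- m\<^sup>2) / (sqrt pi * m) ^ (CARD('n) - 1))
          * (inverse (m\<^sup>2) * exp (- v / m\<^sup>2))"
        by (intro mult_pos_pos divide_pos_pos zero_less_power) simp_all
      then show ?thesis by (simp only: ennreal_eq_0_iff not_le)
    qed
    ultimately have "AE m in lborel. m \<notin> {0<..<1::real}"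
      by (auto elim!: eventually_mono)
    then have "{0<..<1::real} \<in> null_sets lborel" by (simp only: AE_iff_null_sets sets_lborel greaterThanLessThan_borel)
    from null_setsD1[OF this] show False by simp
  qed
  then show ?thesis unfolding radial_density_def zero_less_iff_neq_zero .
qed

text \<open>The fibre over \<open>v\<close> is a ball of radius \<open>sqrt v\<close>, whose volume
  does not depend on \<open>x\<close>. The value is finite because a whole cone has measure 1, and
  positive because the density and the volumes are.\<close>

lemma ball_cone_slab_const:
  assumes "0 \<le> l" "l < u"
  obtains a where "0 < a" "\<And>x. measure (ball_measure TYPE('n::finite)) (ball_cone x \<inter> {l<..u} \<times> UNIV) = a"
proof -
  let ?N = "ball_measure TYPE('n::finite)"
  have ms[measurable]: "ball_cone x \<inter> {l<..u} \<times> UNIV \<in> sets borel" for x :: "real ^ 'n"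
    by (intro sets.Int ball_cone_measurable) (auto intro!: borel_Times)
  define f where "f v = radial_density TYPE('n::finite) v * indicator {l<..u} v * emeasure lborel (cball (0::real ^ 'n) (sqrt v))" for v
  have pt: "(\<integral>\<^sup>+z. radial_density TYPE('n::finite) v * indicator (ball_cone x \<inter> {l<..u} \<times> UNIV) (v, z) \<partial>lborel) = f v" for x :: "real ^ 'n" and v
  proof (cases "v \<in> {l<..u}")
      case True
      then have "0 \<le> v" using assms by auto
      then have "indicator (ball_cone x \<inter> {l<..u} \<times> UNIV) (v, z) = (indicator (cball x (sqrt v)) z :: ennreal)" for z
        using True by (auto simp: ball_cone_def indicator_def dist_norm norm_minus_commute real_le_rsqrt sqrt_ge_absD real_sqrt_le_iff intro: real_le_rsqrt dest: real_sqrt_le_mono)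
      moreover have "emeasure lborel (cball x (sqrt v)) = emeasure lborel (cball (0::real^'n) (sqrt v))"
        using \<open>0 \<le> v\<close> by (simp add: emeasure_cball)
      ultimately show ?thesis using True by (simp add: nn_integral_cmult_indicator f_def)
  qed (simp add: f_def)
  have eq: "emeasure ?N (ball_cone x \<inter> {l<..u} \<times> UNIV) = (\<integral>\<^sup>+v. f v \<partial>lborel)" for x
    unfolding emeasure_ball_measure[OF ms] pt ..
  have "emeasure ?N (ball_cone x \<inter> {l<..u} \<times> UNIV) \<le> emeasure ?N (ball_cone x \<inter> ball_cone x)" for x
    by (intro emeasure_mono) auto
  then have "emeasure ?N (ball_cone x \<inter> {l<..u} \<times> UNIV) \<le> 1" for x
    by (simp only: emeasure_ball_cone_inter) simp
  then have le: "(\<integral>\<^sup>+v. f v \<partial>lborel) \<le> 1" unfolding eq by blast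
  have "(\<integral>\<^sup>+v. f v \<partial>lborel) \<noteq> 0"
  proof
    assume "(\<integral>\<^sup>+v. f v \<partial>lborel) = 0"
    moreover have "f \<in> borel_measurable lborel"
    proof -
      have "f = (\<lambda>v. \<integral>\<^sup>+z. radial_density TYPE('n::finite) v * indicator (ball_cone 0 \<inter> {l<..u} \<times> UNIV) (v, z :: real ^ 'n) \<partial>lborel)"
        by (rule ext) (rule pt[symmetric])
      also have "\<dots> \<in> borel_measurable lborel" by measurable
      finally show ?thesis .
    qed
    ultimately have "AE v in lborel. f v = 0" by (subst (asm) nn_integral_0_iff_AE)
    then have "AE v in lborel. v \<notin> {l<..u}"
    proof eventually_elim
      case (elim v)
      show ?case
      proof
        assume v: "v \<in> {l<..u}"
        then have "0 < sqrt v" using assms by simp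
        then have "emeasure lborel (cball (0::real ^ 'n) (sqrt v)) \<noteq> 0"
          using less_imp_neq[OF unit_ball_vol_pos[of "real CARD('n)"]] by (simp add: emeasure_cball)
        with elim v radial_density_pos[where 'n='n, of v] show False by (auto simp: f_def)
      qed
    qed
    then have "{l<..u} \<in> null_sets lborel" by (simp only: AE_iff_null_sets sets_lborel greaterThanAtMost_borel)
    from null_setsD1[OF this] show False using assms by simp
  qed
  with le have "0 < enn2real (\<integral>\<^sup>+v. f v \<partial>lborel)"
    by (auto simp: enn2real_positive_iff zero_less_iff_neq_zero intro: le_less_trans)
  then show thesis by (rule that) (simp add: measure_def eq)
qed

lemma slab_measurable [measurable]: "{l<..u::real} \<times> (UNIV :: 'a::euclidean_space set) \<in> sets borel"
  by (intro borel_Times) auto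

lemma emeasure_ball_cone_finite: "emeasure (ball_measure TYPE('n::finite)) (ball_cone x) < \<infinity>"
  using emeasure_ball_cone_inter[of x x] by simp

section \<open>The quadratic form of the kernel and its lower bounds\<close>

definition exp_form :: "(real ^ 'n) set \<Rightarrow> (real ^ 'n \<Rightarrow> real) \<Rightarrow> real" where
  "exp_form F w = (\<Sum>x\<in>F. \<Sum>y\<in>F. w x * w y * exp (- dist x y))"

definition cone_sum :: "(real ^ 'n) set \<Rightarrow> (real ^ 'n \<Rightarrow> real) \<Rightarrow> real \<times> (real ^ 'n) \<Rightarrow> real" where
  "cone_sum F w p = (\<Sum>x\<in>F. w x * indicator (ball_cone x) p)"

lemma integral_cone_sum_sq:
  fixes F :: "(real ^ 'n) set"
  assumes "finite F"
  shows "has_bochner_integral (ball_measure TYPE('n)) (\<lambda>p. (cone_sum F w p)\<^sup>2) (exp_form F w)"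
proof -
  have "has_bochner_integral (ball_measure TYPE('n))
      (\<lambda>p. \<Sum>x\<in>F. \<Sum>y\<in>F. w x * w y * indicator (ball_cone x \<inter> ball_cone y) p)
      (\<Sum>x\<in>F. \<Sum>y\<in>F. w x * w y * measure (ball_measure TYPE('n)) (ball_cone x \<inter> ball_cone y))"
    by (intro has_bochner_integral_sum has_bochner_integral_mult_right has_bochner_integral_real_indicator)
      (auto simp: emeasure_ball_cone_inter)
  moreover have "measure (ball_measure TYPE('n)) (ball_cone x \<inter> ball_cone y) = exp (- dist x y)" for x y :: "real ^ 'n"
    by (simp add: measure_def emeasure_ball_cone_inter)
  moreover have "(cone_sum F w p)\<^sup>2 = (\<Sum>x\<in>F. \<Sum>y\<in>F. w x * w y * indicator (ball_cone x \<inter> ball_cone y) p)" for p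
    unfolding cone_sum_def power2_eq_square sum_product
    by (intro sum.cong refl) (simp add: indicator_inter_arith mult_ac)
  ultimately show ?thesis by (simp add: exp_form_def)
qed

lemma has_bochner_integral_mono:
  fixes f g :: "'a \<Rightarrow> real"
  assumes "has_bochner_integral M f a" "has_bochner_integral M g b" "\<And>x. f x \<le> g x"
  shows "a \<le> b"
  using assms integral_mono[of M f g] by (auto simp: has_bochner_integral_iff)

lemma exp_form_nonneg:
  assumes "finite F" shows "0 \<le> exp_form F w"
  by (rule has_bochner_integral_mono[OF has_bochner_integral_zero integral_cone_sum_sq[OF assms]]) simp

text \<open>Balls that contain \<open>x0\<close> and are small compared with its distance
  \<open>r\<close> to the rest of \<open>F\<close> contain no other point of \<open>F\<close>. On
  this set of positive measure \<open>cone_sum\<close> equals \<open>w x0\<close>, so a vanishing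
  norm forces \<open>w x0 = 0\<close>.\<close>

lemma exp_form_eq_0D:
  fixes F :: "(real ^ 'n) set"
  assumes "finite F" "exp_form F w = 0" "x0 \<in> F"
  shows "w x0 = 0"
proof -
  let ?N = "ball_measure TYPE('n)"
  obtain r where r: "0 < r" "\<And>y. y \<in> F \<Longrightarrow> y \<noteq> x0 \<Longrightarrow> r \<le> dist x0 y"
    using finite_set_avoid[OF assms(1), of x0] by metis
  \<comment> \<open>Squared radius of balls of radius \<open>r / 4\<close>: two points in one such
    ball are less than \<open>r\<close> apart.\<close>
  have r4: "0 < r\<^sup>2 / 16" using r by simp
  let ?u = "r\<^sup>2 / 16"
  obtain a where a: "0 < a" "\<And>x :: real ^ 'n. measure ?N (ball_cone x \<inter> {0<..?u} \<times> UNIV) = a"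
    using ball_cone_slab_const[OF order_refl r4, where 'n = 'n] by metis
  let ?S = "ball_cone x0 \<inter> {0<..?u} \<times> UNIV"
  have near: "norm (z - x) < r / 2" if "(v, z) \<in> ball_cone x" "v \<le> ?u" for v and z x :: "real ^ 'n"
  proof -
    have "(norm (z - x))\<^sup>2 \<le> (r / 4)\<^sup>2" using that by (simp add: ball_cone_def power_divide)
    then have "norm (z - x) \<le> r / 4" using r(1) by (simp add: power_mono_iff abs_le_square_iff[symmetric])
    then show ?thesis using r by simp
  qed
  have "cone_sum F w p = w x0" if p: "p \<in> ?S" for p
  proof -
    obtain v z where vz: "p = (v, z)" by fastforce
    have "p \<notin> ball_cone y" if y: "y \<in> F" "y \<noteq> x0" for y
    proof
      assume "p \<in> ball_cone y"
      then have "norm (z - y) < r / 2" using near p vz by auto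
      moreover have "norm (z - x0) < r / 2" using near p vz by auto
      ultimately have "dist x0 y < r"
        using dist_triangle2[of x0 y z] by (simp add: dist_norm norm_minus_commute)
      then show False using r(2)[OF y] by simp
    qed
    then have "cone_sum F w p = (\<Sum>x\<in>F. if x = x0 then w x0 else 0)"
      unfolding cone_sum_def using p by (intro sum.cong) (auto simp: indicator_def)
    then show ?thesis using assms by simp
  qed
  then have le: "(w x0)\<^sup>2 * indicator ?S p \<le> (cone_sum F w p)\<^sup>2" for p
    by (auto simp: indicator_def)
  have "emeasure ?N ?S < \<infinity>"
    using emeasure_mono[of ?S "ball_cone x0" ?N] emeasure_ball_cone_finite[of x0] by (auto intro: le_less_trans)
  then have "has_bochner_integral ?N (\<lambda>p. (w x0)\<^sup>2 * indicator ?S p) ((w x0)\<^sup>2 * measure ?N ?S)"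
    by (intro has_bochner_integral_mult_right has_bochner_integral_real_indicator) auto
  from has_bochner_integral_mono[OF this integral_cone_sum_sq[OF assms(1), of w] le]
  have "(w x0)\<^sup>2 * a \<le> 0" using a assms(2) by simp
  then show ?thesis using a(1) by (simp add: mult_le_0_iff)
qed

text \<open>A ball of radius at most 1 that meets \<open>cball c 2\<close> has its centre in
  \<open>cball c 3\<close>. That region is covered by a fixed number of balls of radius
  \<open>1/2\<close>, around points \<open>c + p\<close>; as the given ball has radius above
  \<open>1/2\<close>, it contains one of these points. So \<open>card K\<close> cones of measure 1
  suffice, with \<open>K\<close> the same for every \<open>c\<close>.\<close>

lemma slab_cover:
  obtains k :: nat where "\<And>c :: real ^ 'n. \<exists>Y\<in>sets borel. emeasure (ball_measure TYPE('n)) Y \<le> of_nat k \<and>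
    (\<forall>x\<in>cball c 2. ball_cone x \<inter> {1/4<..1} \<times> UNIV \<subseteq> Y)"
proof -
  obtain K where K: "finite K" "cball (0 :: real ^ 'n) 3 \<subseteq> (\<Union>p\<in>K. ball p (1/2))"
  proof (rule compactE_image)
    show "compact (cball (0 :: real ^ 'n) 3)" by (rule compact_cball)
    show "cball (0 :: real ^ 'n) 3 \<subseteq> (\<Union>p\<in>UNIV. ball p (1/2))"
    proof
      fix x :: "real ^ 'n"
      show "x \<in> (\<Union>p\<in>UNIV. ball p (1/2))" by (rule UN_I[of x]) auto
    qed
  qed auto
  have "\<exists>Y\<in>sets borel. emeasure (ball_measure TYPE('n)) Y \<le> of_nat (card K) \<and>
    (\<forall>x\<in>cball c 2. ball_cone x \<inter> {1/4<..1} \<times> UNIV \<subseteq> Y)" for c :: "real ^ 'n"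
  proof (intro bexI conjI ballI)
    let ?Y = "\<Union>p\<in>K. ball_cone (c + p)"
    show "?Y \<in> sets borel" using K by auto
    have "emeasure (ball_measure TYPE('n)) ?Y \<le> (\<Sum>p\<in>K. emeasure (ball_measure TYPE('n)) (ball_cone (c + p)))"
      using K(1) by (intro emeasure_subadditive_finite) auto
    also have "\<dots> = (\<Sum>p\<in>K. 1)"
      using emeasure_ball_cone_inter[where 'n = 'n] by (intro sum.cong refl) (metis Int_absorb dist_self minus_zero exp_zero ennreal_1)
    finally show "emeasure (ball_measure TYPE('n)) ?Y \<le> of_nat (card K)" by simp
    fix x assume x: "x \<in> cball c 2"
    show "ball_cone x \<inter> {1/4<..1} \<times> UNIV \<subseteq> ?Y"
    proof (clarify)
      fix v z assume vz: "(v, z) \<in> ball_cone x" "v \<in> {1/4<..1}"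
      then have "(norm (z - x))\<^sup>2 \<le> 1\<^sup>2" by (simp add: ball_cone_def)
      then have "norm (z - x) \<le> 1" by (rule power2_le_imp_le) simp
      moreover have "norm (z - c) \<le> norm (z - x) + norm (x - c)" using norm_triangle_ineq[of "z - x" "x - c"] by simp
      moreover have "norm (x - c) \<le> 2" using x by (simp add: dist_norm norm_minus_commute)
      ultimately have "z - c \<in> cball 0 3" by simp
      then obtain p where p: "p \<in> K" "z - c \<in> ball p (1/2)" using K(2) by blast
      then have "norm (z - (c + p)) \<le> 1/2" by (simp add: dist_norm norm_minus_commute algebra_simps)
      then have "(norm (z - (c + p)))\<^sup>2 \<le> (1/2)\<^sup>2" by (intro power_mono) auto
      then have "(v, z) \<in> ball_cone (c + p)" using vz(2) by (simp add: ball_cone_def power2_eq_square)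
      then show "(v, z) \<in> ?Y" using p(1) by blast
    qed
  qed
  then show thesis by (rule that)
qed

text \<open>Inside the slab all cones over \<open>F\<close> lie in a set \<open>U\<close> of measure
  at most a multiple of \<open>card P\<close>. The integral of \<open>cone_sum\<close> over
  \<open>U\<close> is \<open>a\<close> times the total weight, whatever the signs, and
  Cauchy-Schwarz bounds its square by the measure of \<open>U\<close> times the form.\<close>

lemma exp_form_lower_bound:
  obtains c where "0 < c" "\<And>F P :: (real ^ 'n) set. \<And>w. finite F \<Longrightarrow> finite P \<Longrightarrow> F \<subseteq> (\<Union>p\<in>P. cball p 2) \<Longrightarrow>
    c * (\<Sum>x\<in>F. w x)\<^sup>2 \<le> real (card P) * exp_form F w"
proof -
  let ?N = "ball_measure TYPE('n)"
  let ?V = "{1/4<..1::real} \<times> (UNIV :: (real ^ 'n) set)"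
  obtain k where k: "\<And>c :: real ^ 'n. \<exists>Y\<in>sets borel. emeasure ?N Y \<le> of_nat k \<and>
    (\<forall>x\<in>cball c 2. ball_cone x \<inter> ?V \<subseteq> Y)" using slab_cover by blast
  then have "\<forall>c. \<exists>Y. Y \<in> sets borel \<and> emeasure ?N Y \<le> of_nat k \<and> (\<forall>x\<in>cball c 2. ball_cone x \<inter> ?V \<subseteq> Y)"
    unfolding Bex_def by blast
  from choice[OF this] obtain Y where Y0: "\<forall>c. Y c \<in> sets borel \<and> emeasure ?N (Y c) \<le> of_nat k \<and>
      (\<forall>x\<in>cball c 2. ball_cone x \<inter> ?V \<subseteq> Y c)" by (rule exE)
  then have Y: "Y c \<in> sets borel" "emeasure ?N (Y c) \<le> of_nat k" "x \<in> cball c 2 \<Longrightarrow> ball_cone x \<inter> ?V \<subseteq> Y c" for c x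
    by blast+
  have "0 \<le> (1/4::real)" "1/4 < (1::real)" by simp_all
  then obtain a where a: "0 < a" "\<And>x :: real ^ 'n. measure ?N (ball_cone x \<inter> ?V) = a"
    using ball_cone_slab_const[where 'n = 'n] by metis
  have fin: "emeasure ?N (ball_cone x \<inter> ?V) < \<infinity>" for x :: "real ^ 'n"
    using emeasure_mono[of "ball_cone x \<inter> ?V" "ball_cone x" ?N] emeasure_ball_cone_finite[of x] by (auto intro: le_less_trans)
  have main: "a\<^sup>2 * (\<Sum>x\<in>F. w x)\<^sup>2 \<le> real (k + 1) * real (card P) * exp_form F w"
    if F: "finite F" and P: "finite P" and cover: "F \<subseteq> (\<Union>p\<in>P. cball p 2)" for F P :: "(real ^ 'n) set" and w
  proof (cases "P = {}")
    case True
    then show ?thesis using cover by simp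
  next
    case False
    let ?U = "?V \<inter> (\<Union>p\<in>P. Y p)"
    have U[measurable]: "?U \<in> sets borel" using P Y(1) by auto
    have "emeasure ?N ?U \<le> emeasure ?N (\<Union>p\<in>P. Y p)"
      using P Y(1) by (intro emeasure_mono) auto
    also have "\<dots> \<le> (\<Sum>p\<in>P. emeasure ?N (Y p))"
      using P Y(1) by (intro emeasure_subadditive_finite) auto
    also have "\<dots> \<le> (\<Sum>p\<in>P. of_nat k)" by (intro sum_mono Y(2))
    also have "\<dots> = of_nat (card P * k)" by simp
    finally have leU: "emeasure ?N ?U \<le> ennreal (real (card P * k))" by (simp only: ennreal_of_nat_eq_real_of_nat)
    then have finU: "emeasure ?N ?U < \<infinity>" by (auto intro: le_less_trans)
    \<comment> \<open>Adding 1 to \<open>k\<close> keeps this divisor positive even if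
      \<open>k = 0\<close>.\<close>
    define K where "K = real (k + 1) * real (card P)"
    have K: "0 < K" using False P by (simp add: K_def card_gt_0_iff)
    have "measure ?N ?U \<le> real (card P * k)"
      unfolding measure_def using leU by (intro enn2real_leI) simp_all
    then have mU: "measure ?N ?U \<le> K" by (simp add: K_def algebra_simps)
    define S where "S = a * (\<Sum>x\<in>F. w x)"
    \<comment> \<open>The maximiser of \<open>2 * l * S - l\<^sup>2 * K\<close>; integrating
      \<open>(cone_sum F w p - l)\<^sup>2 \<ge> 0\<close> over \<open>U\<close> with this
      \<open>l\<close> yields Cauchy-Schwarz.\<close>
    define l where "l = S / K"
    have eq: "ball_cone x \<inter> ?U = ball_cone x \<inter> ?V" if "x \<in> F" for x
      using cover Y(3) that by blast
    have ind: "has_bochner_integral ?N (indicat_real (ball_cone x \<inter> ?V)) a" for x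
      using has_bochner_integral_real_indicator[OF _ fin[of x]] a(2) by simp
    have int1: "has_bochner_integral ?N (\<lambda>p. \<Sum>x\<in>F. w x * indicator (ball_cone x \<inter> ?U) p) (\<Sum>x\<in>F. w x * a)"
      by (intro has_bochner_integral_sum has_bochner_integral_mult_right) (simp add: eq ind)
    have int2: "has_bochner_integral ?N (\<lambda>p. indicator ?U p) (measure ?N ?U)"
      using finU by (intro has_bochner_integral_real_indicator) auto
    have sum: "(\<Sum>x\<in>F. w x * indicator (ball_cone x \<inter> ?U) p) = cone_sum F w p * indicator ?U p" for p
      unfolding cone_sum_def sum_distrib_right by (intro sum.cong) (auto simp: indicator_def)
    have "has_bochner_integral ?N (\<lambda>p. 2 * l * (cone_sum F w p * indicator ?U p) - l\<^sup>2 * indicator ?U p)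
        (2 * l * (\<Sum>x\<in>F. w x * a) - l\<^sup>2 * measure ?N ?U)"
      by (intro has_bochner_integral_diff has_bochner_integral_mult_right int1[unfolded sum] int2)
    moreover have "2 * l * (cone_sum F w p * indicator ?U p) - l\<^sup>2 * indicator ?U p \<le> (cone_sum F w p)\<^sup>2" for p
    proof -
      have "0 \<le> (cone_sum F w p - l)\<^sup>2" by simp
      then show ?thesis by (auto simp: indicator_def power2_diff algebra_simps)
    qed
    ultimately have "2 * l * (\<Sum>x\<in>F. w x * a) - l\<^sup>2 * measure ?N ?U \<le> exp_form F w"
      by (rule has_bochner_integral_mono[OF _ integral_cone_sum_sq[OF F, of w]])
    moreover have "(\<Sum>x\<in>F. w x * a) = S" by (simp add: S_def sum_distrib_left mult.commute)
    moreover have "l\<^sup>2 * measure ?N ?U \<le> l\<^sup>2 * K" using mU by (intro mult_left_mono) auto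
    ultimately have "2 * l * S - l\<^sup>2 * K \<le> exp_form F w" by simp
    moreover have "2 * l * S - l\<^sup>2 * K = S\<^sup>2 / K" using K by (simp add: l_def power2_eq_square field_simps)
    ultimately have "S\<^sup>2 / K \<le> exp_form F w" by linarith
    then have "S\<^sup>2 \<le> K * exp_form F w" using K by (simp add: pos_divide_le_eq mult.commute)
    then show ?thesis by (simp add: S_def K_def power_mult_distrib)
  qed
  show thesis
  proof (rule that)
    show "0 < a\<^sup>2 / real (k + 1)" using a by simp
    fix F P :: "(real ^ 'n) set" and w assume "finite F" "finite P" "F \<subseteq> (\<Union>p\<in>P. cball p 2)"
    from main[OF this, of w] show "a\<^sup>2 / real (k + 1) * (\<Sum>x\<in>F. w x)\<^sup>2 \<le> real (card P) * exp_form F w"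
      by (simp add: field_simps)
  qed
qed

section \<open>Separated sets in Euclidean space\<close>

lemma separated_disjoint:
  assumes "separated r S"
  shows "disjoint_family_on (\<lambda>y. cball y (r / 2)) S"
  unfolding disjoint_family_on_def
proof (intro ballI impI equals0I)
  fix x y z assume xy: "x \<in> S" "y \<in> S" "x \<noteq> y" and z: "z \<in> cball x (r / 2) \<inter> cball y (r / 2)"
  then have "r < dist x y" using assms by (simp add: separated_def)
  moreover have "dist x y \<le> dist x z + dist y z" by (rule dist_triangle2)
  moreover have "dist x z \<le> r / 2" "dist y z \<le> r / 2" using z by simp_all
  ultimately show False by linarith
qed

text \<open>The norm dominates the mean of the absolute coordinates, so the integrand is at most a
  product of one-dimensional exponentials.\<close>

lemma nn_integral_exp_norm_finite:
  "(\<integral>\<^sup>+z. ennreal (exp (- norm (z :: 'a::euclidean_space))) \<partial>lborel) < \<infinity>"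
proof -
  let ?D = "real DIM('a)"
  have D: "0 < ?D" by simp
  have one: "(\<integral>\<^sup>+s. ennreal (exp (- \<bar>s\<bar> / ?D)) \<partial>lborel) = ennreal (2 * ?D)"
    using D nn_integral_exp_abs
    by (subst nn_integral_real_affine[of _ "2 * ?D" 0]) (auto simp: abs_mult)
  have "(\<integral>\<^sup>+z. ennreal (exp (- norm (z :: 'a))) \<partial>lborel)
      \<le> (\<integral>\<^sup>+z. (\<Prod>b\<in>Basis. ennreal (exp (- \<bar>z \<bullet> b\<bar> / ?D))) \<partial>(lborel :: 'a measure))"
  proof (rule nn_integral_mono)
    fix z :: 'a
    have "(\<Sum>b\<in>Basis. \<bar>z \<bullet> b\<bar>) \<le> (\<Sum>b\<in>(Basis::'a set). norm z)" by (intro sum_mono Basis_le_norm)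
    then have "(\<Sum>b\<in>Basis. \<bar>z \<bullet> b\<bar>) / ?D \<le> norm z" using D by (simp add: divide_le_eq mult.commute)
    then have "exp (- norm z) \<le> exp (\<Sum>b\<in>Basis. - \<bar>z \<bullet> b\<bar> / ?D)"
      by (simp add: sum_negf sum_divide_distrib)
    then show "ennreal (exp (- norm z)) \<le> (\<Prod>b\<in>Basis. ennreal (exp (- \<bar>z \<bullet> b\<bar> / ?D)))"
      by (simp add: prod_ennreal exp_sum ennreal_leI)
  qed
  also have "\<dots> = (\<Prod>b\<in>(Basis::'a set). \<integral>\<^sup>+s. ennreal (exp (- \<bar>s\<bar> / ?D)) \<partial>lborel)"
    by (rule nn_integral_lborel_prod) auto
  also have "\<dots> < \<infinity>" unfolding one by (simp add: ennreal_power[symmetric] power_less_top_ennreal)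
  finally show ?thesis .
qed

text \<open>Balls of radius \<open>1/2\<close> around the points of \<open>S\<close> are disjoint,
  and on each of them \<open>exp (- dist x z)\<close> is at least \<open>exp (- 1/2)\<close> times
  its value at the centre. The sum is thus controlled by one integral over the whole space,
  independent of \<open>S\<close> and \<open>x\<close>.\<close>

lemma separated_sum_exp_bound:
  obtains C where "0 < C" "\<And>S (x :: 'a::euclidean_space). finite S \<Longrightarrow> separated 1 S \<Longrightarrow> (\<Sum>y\<in>S. exp (- dist x y)) \<le> C"
proof -
  let ?E = "\<integral>\<^sup>+z. ennreal (exp (- norm (z :: 'a))) \<partial>lborel"
  have [measurable]: "cball y (1/2) \<in> sets borel" for y :: 'a by simp
  define b where "b = measure lborel (cball (0::'a) (1/2))"
  have b: "0 < b" "emeasure lborel (cball y (1/2)) = ennreal b" for y :: 'a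
    by (simp_all add: b_def measure_def emeasure_cball enn2real_mult)
  define E where "E = enn2real ?E"
  have E: "?E = ennreal E" "0 \<le> E" using nn_integral_exp_norm_finite[where 'a='a] by (simp_all add: E_def)
  have main: "(\<Sum>y\<in>S. exp (- dist x y)) * b \<le> exp (1/2) * E"
    if S: "finite S" "separated 1 S" for S and x :: 'a
  proof -
    have trl: "(\<integral>\<^sup>+z. ennreal (exp (- dist x z)) \<partial>lborel) = ?E"
      by (subst lborel_distr_plus[of x, symmetric]) (simp add: nn_integral_distr dist_norm)
    have le1: "(\<Sum>y\<in>S. indicator (cball y (1/2)) z) \<le> (1::ennreal)" for z
    proof -
      have "(\<Sum>y\<in>S. indicator (cball y (1/2)) z) = (indicator (\<Union>y\<in>S. cball y (1/2)) z :: ennreal)"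
        using S(1) separated_disjoint[OF S(2)] by (simp add: indicator_UN_disjoint)
      then show ?thesis by (simp add: indicator_def)
    qed
    have "ennreal ((\<Sum>y\<in>S. exp (- dist x y)) * b) = (\<Sum>y\<in>S. ennreal (exp (- dist x y)) * emeasure lborel (cball y (1/2)))"
      unfolding b(2) using b(1) by (simp add: ennreal_mult[symmetric] sum_distrib_right sum_nonneg)
    also have "\<dots> = (\<Sum>y\<in>S. \<integral>\<^sup>+z. ennreal (exp (- dist x y)) * indicator (cball y (1/2)) z \<partial>lborel)"
      by (simp add: nn_integral_cmult_indicator)
    also have "\<dots> \<le> (\<Sum>y\<in>S. \<integral>\<^sup>+z. ennreal (exp (1/2) * exp (- dist x z)) * indicator (cball y (1/2)) z \<partial>lborel)"
    proof (intro sum_mono nn_integral_mono)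
      fix y z
      show "ennreal (exp (- dist x y)) * indicator (cball y (1/2)) z \<le> ennreal (exp (1/2) * exp (- dist x z)) * indicator (cball y (1/2)) z"
        using dist_triangle[of x z y] by (auto simp: indicator_def exp_add[symmetric] intro!: ennreal_leI)
    qed
    also have "\<dots> = (\<integral>\<^sup>+z. (\<Sum>y\<in>S. ennreal (exp (1/2) * exp (- dist x z)) * indicator (cball y (1/2)) z) \<partial>lborel)"
      by (rule nn_integral_sum[symmetric]) measurable
    also have "\<dots> \<le> (\<integral>\<^sup>+z. ennreal (exp (1/2)) * ennreal (exp (- dist x z)) \<partial>lborel)"
    proof (rule nn_integral_mono)
      fix z
      show "(\<Sum>y\<in>S. ennreal (exp (1/2) * exp (- dist x z)) * indicator (cball y (1/2)) z) \<le> ennreal (exp (1/2)) * ennreal (exp (- dist x z))"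
        unfolding sum_distrib_left[symmetric] ennreal_mult[symmetric, OF exp_ge_zero exp_ge_zero]
        using mult_left_mono[OF le1[of z], of "ennreal (exp (1/2) * exp (- dist x z))"] by simp
    qed
    also have "\<dots> = ennreal (exp (1/2)) * ?E"
      unfolding trl[symmetric] by (rule nn_integral_cmult) measurable
    also have "\<dots> = ennreal (exp (1/2) * E)" unfolding E(1) using E(2) by (simp add: ennreal_mult)
    finally show ?thesis using E(2) by (simp add: ennreal_le_iff)
  qed
  show thesis
  proof (rule that)
    \<comment> \<open>The summand 1 gives positivity from \<open>0 \<le> E\<close> alone.\<close>
    show "0 < exp (1/2) * E / b + 1" using E(2) b(1) by (intro add_nonneg_pos) auto
    fix S :: "'a set" and x :: 'a assume "finite S" "separated 1 S"
    from main[OF this, of x] show "(\<Sum>y\<in>S. exp (- dist x y)) \<le> exp (1/2) * E / b + 1"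
      using b(1) by (simp add: field_simps add_increasing2)
  qed
qed

text \<open>Volume comparison: disjoint balls of radius \<open>r / 2\<close> around points of
  \<open>cball 0 R\<close> fit into \<open>cball 0 (R + 1)\<close>, as
  \<open>r \<le> 1\<close>.\<close>

lemma separated_card_bound:
  fixes S :: "'a::euclidean_space set"
  assumes "finite S" "separated r S" "0 < r" "r \<le> 1" "S \<subseteq> cball 0 R" "0 \<le> R"
  shows "real (card S) \<le> (2 * (R + 1)) ^ DIM('a) * r powr (- real DIM('a))"
proof -
  let ?n = "DIM('a)"
  let ?\<omega> = "unit_ball_vol (real ?n)"
  have "ennreal (real (card S) * (?\<omega> * (r / 2) ^ ?n)) = (\<Sum>y\<in>S. emeasure lborel (cball y (r / 2)))"
    using assms by (simp add: emeasure_cball ennreal_mult ennreal_of_nat_eq_real_of_nat)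
  also have "\<dots> = emeasure lborel (\<Union>y\<in>S. cball y (r / 2))"
    using assms separated_disjoint[OF assms(2)] by (intro sum_emeasure) auto
  also have "\<dots> \<le> emeasure lborel (cball (0::'a) (R + 1))"
  proof (intro emeasure_mono subsetI)
    fix z assume "z \<in> (\<Union>y\<in>S. cball y (r / 2))"
    then obtain y where y: "y \<in> S" "dist y z \<le> r / 2" by auto
    then have "norm y \<le> R" using assms(5) by auto
    then show "z \<in> cball 0 (R + 1)" using y(2) assms dist_triangle[of 0 z y] by simp
  qed simp
  also have "\<dots> = ennreal (?\<omega> * (R + 1) ^ ?n)" using assms by (simp add: emeasure_cball)
  finally have "real (card S) * (?\<omega> * (r / 2) ^ ?n) \<le> ?\<omega> * (R + 1) ^ ?n"
    using assms by (subst (asm) ennreal_le_iff) auto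
  then have "?\<omega> * (real (card S) * (r / 2) ^ ?n) \<le> ?\<omega> * (R + 1) ^ ?n" by (simp only: mult_ac)
  then have "real (card S) * (r / 2) ^ ?n \<le> (R + 1) ^ ?n"
    by (rule mult_left_le_imp_le) simp
  then have "2 ^ ?n * (real (card S) * (r / 2) ^ ?n) \<le> 2 ^ ?n * (R + 1) ^ ?n"
    by (rule mult_left_mono) simp
  then have "real (card S) * r ^ ?n \<le> (2 * (R + 1)) ^ ?n"
    by (simp only: power_divide power_mult_distrib) (simp add: mult.left_commute)
  then show ?thesis using assms(3) by (simp add: powr_minus powr_realpow divide_inverse[symmetric] le_divide_eq)
qed

section \<open>Magnitude of finite spaces\<close>

definition metric_form :: "('a \<Rightarrow> 'a \<Rightarrow> real) \<Rightarrow> 'a set \<Rightarrow> ('a \<Rightarrow> real) \<Rightarrow> ('a \<Rightarrow> real) \<Rightarrow> real" where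
  "metric_form d F u w = (\<Sum>x\<in>F. \<Sum>y\<in>F. u x * w y * exp (- d x y))"

text \<open>A solution of the linear system with right-hand side 1, indexed by points instead of
  matrix positions. Its total mass is the magnitude.\<close>

definition weighting :: "('a \<Rightarrow> 'a \<Rightarrow> real) \<Rightarrow> 'a set \<Rightarrow> ('a \<Rightarrow> real) \<Rightarrow> bool" where
  "weighting d F w \<longleftrightarrow> (\<forall>x\<in>F. (\<Sum>y\<in>F. w y * exp (- d x y)) = 1)"

text \<open>For \<open>u = w\<close> this identifies the magnitude with the value of the form at the
  weighting; both bounds on the magnitude rest on it.\<close>

lemma metric_form_weighting:
  assumes "weighting d F w" shows "metric_form d F u w = (\<Sum>x\<in>F. u x)"
  unfolding metric_form_def
proof (rule sum.cong)
  fix x assume "x \<in> F"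
  have "(\<Sum>y\<in>F. u x * w y * exp (- d x y)) = u x * (\<Sum>y\<in>F. w y * exp (- d x y))"
    by (simp add: sum_distrib_left mult_ac)
  then show "(\<Sum>y\<in>F. u x * w y * exp (- d x y)) = u x"
    using assms \<open>x \<in> F\<close> by (simp add: weighting_def)
qed simp

lemma metric_form_commute:
  assumes "\<And>x y. d x y = d y x" shows "metric_form d F u w = metric_form d F w u"
  unfolding metric_form_def by (subst sum.swap) (simp add: assms mult_ac)

text \<open>By symmetry, pairing \<open>w\<close> with \<open>w'\<close> evaluates to either sum.
  Hence the magnitude does not depend on the enumeration or on the chosen inverse.\<close>

lemma sum_weighting_unique:
  assumes "\<And>x y. d x y = d y x" "weighting d F w" "weighting d F w'"
  shows "(\<Sum>x\<in>F. w x) = (\<Sum>x\<in>F. w' x)"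
  using metric_form_commute[of d F w w'] metric_form_weighting assms by metis

lemma similarity_matrix_carrier: "similarity_matrix d xs \<in> carrier_mat (length xs) (length xs)"
  by (simp add: similarity_matrix_def)

lemma sum_set_nth:
  assumes "distinct xs" shows "(\<Sum>x\<in>set xs. f x) = (\<Sum>i<length xs. f (xs ! i))"
  using sum.reindex_bij_betw[OF bij_betw_nth[OF assms refl refl], of f] by simp

lemma ex_function_on_nth:
  assumes "distinct xs" obtains w where "\<And>i. i < length xs \<Longrightarrow> w (xs ! i) = f i"
proof (rule that)
  fix i assume "i < length xs"
  then show "(\<lambda>x. f (the_inv_into {..<length xs} ((!) xs) x)) (xs ! i) = f i"
    using assms by (simp add: the_inv_into_f_f inj_on_nth)
qed

text \<open>The weighting consists of the row sums of \<open>B\<close>, that is, \<open>B\<close>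
  applied to the all-ones vector.\<close>

lemma has_magnitude_weighting:
  assumes "has_magnitude d F m"
  obtains w where "weighting d F w" "m = (\<Sum>x\<in>F. w x)"
proof -
  obtain xs B where xs: "distinct xs" "set xs = F"
    and AB: "inverts_mat (similarity_matrix d xs) B" and BA: "inverts_mat B (similarity_matrix d xs)"
    and m: "m = (\<Sum>i<length xs. \<Sum>j<length xs. B $$ (i, j))"
    using assms unfolding has_magnitude_def by blast
  let ?n = "length xs" and ?A = "similarity_matrix d xs"
  have 1: "?A * B = 1\<^sub>m ?n" "B * ?A = 1\<^sub>m (dim_row B)"
    using AB BA by (simp_all add: inverts_mat_def similarity_matrix_def)
  \<comment> \<open>\<open>inverts_mat\<close> leaves the shape of \<open>B\<close> open; comparing
    column counts in the two identities determines it.\<close>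
  have "dim_col B = ?n" using arg_cong[OF 1(1), of dim_col] by simp
  moreover have "dim_row B = ?n" using arg_cong[OF 1(2), of dim_col] by (simp add: similarity_matrix_def)
  ultimately have B: "B \<in> carrier_mat ?n ?n" by auto
  obtain w where w: "\<And>i. i < ?n \<Longrightarrow> w (xs ! i) = (\<Sum>j<?n. B $$ (i, j))"
    using ex_function_on_nth[OF xs(1), of "\<lambda>i. \<Sum>j<?n. B $$ (i, j)"] by blast
  show thesis
  proof (rule that)
    show "m = (\<Sum>x\<in>F. w x)" unfolding m xs(2)[symmetric] sum_set_nth[OF xs(1)] by (simp add: w)
    show "weighting d F w" unfolding weighting_def
    proof
      fix x assume "x \<in> F"
      then obtain k where k: "k < ?n" "x = xs ! k" using xs(2) by (metis in_set_conv_nth)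
      have "(\<Sum>y\<in>F. w y * exp (- d x y)) = (\<Sum>i<?n. \<Sum>j<?n. ?A $$ (k, i) * B $$ (i, j))"
        unfolding xs(2)[symmetric] sum_set_nth[OF xs(1)]
        using k by (intro sum.cong) (simp_all add: w similarity_matrix_def sum_distrib_left mult.commute)
      also have "\<dots> = (\<Sum>j<?n. \<Sum>i<?n. ?A $$ (k, i) * B $$ (i, j))" by (rule sum.swap)
      also have "\<dots> = (\<Sum>j<?n. (?A * B) $$ (k, j))"
      proof (rule sum.cong)
        fix j assume "j \<in> {..<?n}"
        then show "(\<Sum>i<?n. ?A $$ (k, i) * B $$ (i, j)) = (?A * B) $$ (k, j)"
          using k B similarity_matrix_carrier[of d xs]
          by (auto simp: scalar_prod_def atLeast0LessThan intro!: sum.cong)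
      qed simp
      also have "\<dots> = 1" unfolding 1 using k by simp
      finally show "(\<Sum>y\<in>F. w y * exp (- d x y)) = 1" .
    qed
  qed
qed

text \<open>A kernel vector of a singular similarity matrix would be a nonzero null vector of the
  form.\<close>

lemma ex_has_magnitude:
  assumes "finite F" and pd: "\<And>w x. metric_form d F w w = 0 \<Longrightarrow> x \<in> F \<Longrightarrow> w x = 0"
  obtains m where "has_magnitude d F m"
proof -
  obtain xs where xs: "distinct xs" "set xs = F" using finite_distinct_list[OF assms(1)] by blast
  let ?n = "length xs" and ?A = "similarity_matrix d xs"
  have A: "?A \<in> carrier_mat ?n ?n" by (rule similarity_matrix_carrier)
  have "Determinant.det ?A \<noteq> 0"
  proof
    assume "Determinant.det ?A = 0"
    then obtain v where v: "v \<in> carrier_vec ?n" "v \<noteq> 0\<^sub>v ?n" "?A *\<^sub>v v = 0\<^sub>v ?n"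
      using det_0_iff_vec_prod_zero_field[OF A] by auto
    obtain w where w: "\<And>i. i < ?n \<Longrightarrow> w (xs ! i) = v $ i"
      using ex_function_on_nth[OF xs(1)] by metis
    have "metric_form d F w w = (\<Sum>i<?n. v $ i * (\<Sum>j<?n. ?A $$ (i, j) * v $ j))"
      unfolding metric_form_def xs(2)[symmetric] sum_set_nth[OF xs(1)]
      by (intro sum.cong) (simp_all add: w similarity_matrix_def sum_distrib_left mult_ac)
    also have "\<dots> = (\<Sum>i<?n. v $ i * (?A *\<^sub>v v) $ i)"
    proof (rule sum.cong)
      fix i assume "i \<in> {..<?n}"
      then have "(?A *\<^sub>v v) $ i = (\<Sum>j<?n. ?A $$ (i, j) * v $ j)"
        using A v(1) by (auto simp: scalar_prod_def atLeast0LessThan intro!: sum.cong)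
      then show "v $ i * (\<Sum>j<?n. ?A $$ (i, j) * v $ j) = v $ i * (?A *\<^sub>v v) $ i" by simp
    qed simp
    also have "\<dots> = 0" unfolding v(3) by simp
    finally have "metric_form d F w w = 0" .
    then have "v $ i = 0" if "i < ?n" for i
      using pd[of w "xs ! i"] w[OF that] that xs(2) by auto
    then have "v = 0\<^sub>v ?n" using v(1) by (intro eq_vecI) auto
    with v(2) show False ..
  qed
  from det_non_zero_imp_unit[OF A this, unfolded Units_def ring_mat_def]
  obtain B where B: "B \<in> carrier_mat ?n ?n" "B * ?A = 1\<^sub>m ?n" "?A * B = 1\<^sub>m ?n"
    by auto
  then have "inverts_mat ?A B" "inverts_mat B ?A" using A by (auto simp: inverts_mat_def)
  with xs have "has_magnitude d F (\<Sum>i<?n. \<Sum>j<?n. B $$ (i, j))"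
    unfolding has_magnitude_def by blast
  then show thesis by (rule that)
qed

lemma finite_magnitude_weighting:
  assumes "finite F" and sym: "\<And>x y. d x y = d y x"
    and pd: "\<And>w x. metric_form d F w w = 0 \<Longrightarrow> x \<in> F \<Longrightarrow> w x = 0"
  obtains w where "weighting d F w" "finite_magnitude d F = (\<Sum>x\<in>F. w x)"
proof -
  obtain m where m: "has_magnitude d F m" using ex_has_magnitude[of F d] assms(1) pd by blast
  then obtain w where w: "weighting d F w" "m = (\<Sum>x\<in>F. w x)" by (rule has_magnitude_weighting)
  have "finite_magnitude d F = m" unfolding finite_magnitude_def
  proof (rule the_equality)
    fix m' assume "has_magnitude d F m'"
    then obtain w' where "weighting d F w'" "m' = (\<Sum>x\<in>F. w' x)" by (rule has_magnitude_weighting)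
    then show "m' = m" using sum_weighting_unique[OF sym w(1)] w(2) by simp
  qed (rule m)
  with w that show thesis by blast
qed

text \<open>Moves the scale from the metric to the points, so that the ball measure is needed only
  for the unscaled kernel.\<close>

lemma metric_form_scale:
  fixes F :: "(real ^ 'n) set"
  assumes "0 < t"
  shows "metric_form (\<lambda>x y. t * dist x y) F w w = exp_form ((*\<^sub>R) t ` F) (\<lambda>x. w (x /\<^sub>R t))"
proof -
  have inj: "inj_on ((*\<^sub>R) t) F" using assms by (auto simp: inj_on_def)
  have "dist (t *\<^sub>R x) (t *\<^sub>R y) = t * dist x y" for x y :: "real ^ 'n"
    using assms by (simp add: dist_norm scaleR_diff_right[symmetric])
  then show ?thesis
    using assms by (simp add: metric_form_def exp_form_def sum.reindex[OF inj])
qed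

lemma metric_form_nonneg:
  fixes F :: "(real ^ 'n) set"
  assumes "0 < t" "finite F"
  shows "0 \<le> metric_form (\<lambda>x y. t * dist x y) F w w"
  unfolding metric_form_scale[OF assms(1)] using assms by (intro exp_form_nonneg) simp

lemma ex_magnitude_weighting:
  fixes F :: "(real ^ 'n) set"
  assumes "0 < t" "finite F"
  obtains w where "weighting (\<lambda>x y. t * dist x y) F w"
    "finite_magnitude (\<lambda>x y. t * dist x y) F = (\<Sum>x\<in>F. w x)"
proof (rule finite_magnitude_weighting[of F "\<lambda>x y. t * dist x y"])
  fix w x assume "metric_form (\<lambda>x y. t * dist x y) F w w = 0" "x \<in> F"
  then show "w x = 0"
    using exp_form_eq_0D[of "(*\<^sub>R) t ` F" "\<lambda>x. w (x /\<^sub>R t)" "t *\<^sub>R x"] assms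
    by (simp add: metric_form_scale)
qed (use assms that in \<open>auto simp: dist_commute\<close>)

text \<open>At a weighting, the form and the total weight both equal the magnitude \<open>M\<close>,
  so the lower bound on the form reads \<open>c * M\<^sup>2 \<le> card P * M\<close>; cancel
  \<open>M\<close>.\<close>

lemma finite_magnitude_upper:
  obtains C where "0 < C" "\<And>t F P :: (real ^ 'n) set. 0 < t \<Longrightarrow> finite F \<Longrightarrow> finite P \<Longrightarrow>
    F \<subseteq> (\<Union>p\<in>P. cball p (2 / t)) \<Longrightarrow> finite_magnitude (\<lambda>x y. t * dist x y) F \<le> C * real (card P)"
proof -
  obtain c where c: "0 < c" "\<And>F P :: (real ^ 'n) set. \<And>w. finite F \<Longrightarrow> finite P \<Longrightarrow> F \<subseteq> (\<Union>p\<in>P. cball p 2) \<Longrightarrow>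
    c * (\<Sum>x\<in>F. w x)\<^sup>2 \<le> real (card P) * exp_form F w"
    using exp_form_lower_bound by blast
  show thesis
  proof (rule that)
    show "0 < 1 / c" using c by simp
    fix t :: real and F P :: "(real ^ 'n) set"
    assume t: "0 < t" and F: "finite F" and P: "finite P" and cover: "F \<subseteq> (\<Union>p\<in>P. cball p (2 / t))"
    let ?d = "\<lambda>x y :: real ^ 'n. t * dist x y"
    obtain w where w: "weighting ?d F w" "finite_magnitude ?d F = (\<Sum>x\<in>F. w x)"
      using ex_magnitude_weighting[OF t F] by blast
    let ?M = "\<Sum>x\<in>F. w x"
    have inj: "inj_on ((*\<^sub>R) t) A" for A :: "(real ^ 'n) set" using t by (auto simp: inj_on_def)
    have form: "exp_form ((*\<^sub>R) t ` F) (\<lambda>x. w (x /\<^sub>R t)) = ?M"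
      using metric_form_weighting[OF w(1), of w] by (simp add: metric_form_scale[OF t])
    have sum: "(\<Sum>x\<in>(*\<^sub>R) t ` F. w (x /\<^sub>R t)) = ?M"
      using t by (simp add: sum.reindex[OF inj])
    have "(*\<^sub>R) t ` F \<subseteq> (\<Union>p\<in>(*\<^sub>R) t ` P. cball p 2)"
    proof
      fix y assume "y \<in> (*\<^sub>R) t ` F"
      then obtain x where x: "x \<in> F" "y = t *\<^sub>R x" by auto
      then obtain p where "p \<in> P" "dist p x \<le> 2 / t" using cover by auto
      moreover have "dist (t *\<^sub>R p) (t *\<^sub>R x) = t * dist p x"
        using t by (simp add: dist_norm scaleR_diff_right[symmetric])
      ultimately show "y \<in> (\<Union>p\<in>(*\<^sub>R) t ` P. cball p 2)" using t x(2)
        by (auto simp: field_simps intro!: bexI[of _ p])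
    qed
    from c(2)[OF _ _ this, of "\<lambda>x. w (x /\<^sub>R t)"]
    have le: "c * ?M\<^sup>2 \<le> real (card P) * ?M"
      using F P by (simp add: form sum card_image[OF inj])
    \<comment> \<open>\<open>M\<close> is a value of a nonnegative form; this allows the
      cancellation, with \<open>M = 0\<close> trivial.\<close>
    have "0 \<le> ?M"
      using metric_form_nonneg[OF t F, of w] metric_form_weighting[OF w(1), of w] by simp
    then have "c * ?M \<le> real (card P)"
      using le by (cases "?M = 0") (auto simp: power2_eq_square)
    then show "finite_magnitude ?d F \<le> 1 / c * real (card P)"
      unfolding w(2) using c(1) by (simp add: field_simps)
  qed
qed

text \<open>The indicator \<open>u\<close> of \<open>P\<close> has form at most
  \<open>C * card P\<close>, because the row sums over a separated set are bounded by
  \<open>C\<close>, and it pairs with the weighting to \<open>card P\<close>. Nonnegativity of the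
  form then forces the magnitude up.\<close>

lemma finite_magnitude_lower:
  obtains C where "0 < C" "\<And>t F P :: (real ^ 'n) set. 0 < t \<Longrightarrow> finite F \<Longrightarrow> P \<subseteq> F \<Longrightarrow>
    separated (1 / t) P \<Longrightarrow> real (card P) \<le> C * finite_magnitude (\<lambda>x y. t * dist x y) F"
proof -
  obtain C where C: "0 < C" "\<And>S (x :: real ^ 'n). finite S \<Longrightarrow> separated 1 S \<Longrightarrow> (\<Sum>y\<in>S. exp (- dist x y)) \<le> C"
    using separated_sum_exp_bound[where 'a = "real ^ 'n"] by blast
  show thesis
  proof (rule that[OF C(1)])
    fix t :: real and F P :: "(real ^ 'n) set"
    assume t: "0 < t" and F: "finite F" and P: "P \<subseteq> F" and sep: "separated (1 / t) P"
    let ?d = "\<lambda>x y :: real ^ 'n. t * dist x y"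
    have sc: "dist (t *\<^sub>R x) (t *\<^sub>R y) = t * dist x y" for x y :: "real ^ 'n"
      using t by (simp add: dist_norm scaleR_diff_right[symmetric])
    have inj: "inj_on ((*\<^sub>R) t) A" for A :: "(real ^ 'n) set" using t by (auto simp: inj_on_def)
    have finP: "finite P" using P F by (rule finite_subset)
    obtain w where w: "weighting ?d F w" "finite_magnitude ?d F = (\<Sum>x\<in>F. w x)"
      using ex_magnitude_weighting[OF t F] by blast
    let ?M = "\<Sum>x\<in>F. w x" and ?p = "real (card P)"
    define u where "u x = (if x \<in> P then 1 else 0 :: real)" for x
    have sepP: "separated 1 ((*\<^sub>R) t ` P)"
      using sep t by (auto simp: separated_def sc field_simps)
    have row: "(\<Sum>y\<in>P. exp (- ?d x y)) \<le> C" for x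
      using C(2)[OF _ sepP, of "t *\<^sub>R x"] finP by (simp add: sum.reindex[OF inj] sc)
    have "metric_form ?d F u u = (\<Sum>x\<in>P. \<Sum>y\<in>P. u x * u y * exp (- ?d x y))"
    proof -
      have "(\<Sum>y\<in>F. u x * u y * exp (- ?d x y)) = (\<Sum>y\<in>P. u x * u y * exp (- ?d x y))" for x
        using F P by (intro sum.mono_neutral_right) (auto simp: u_def)
      then show ?thesis unfolding metric_form_def
        using F P by (simp only:) (intro sum.mono_neutral_right, auto simp: u_def)
    qed
    also have "\<dots> = (\<Sum>x\<in>P. \<Sum>y\<in>P. exp (- ?d x y))"
      by (intro sum.cong) (auto simp: u_def)
    also have "\<dots> \<le> (\<Sum>x\<in>P. C)" by (intro sum_mono row)
    finally have uu: "metric_form ?d F u u \<le> ?p * C" by simp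
    have uw: "metric_form ?d F u w = ?p"
      unfolding metric_form_weighting[OF w(1)] using F P by (simp add: u_def sum.If_cases Int_absorb1)
    have wu: "metric_form ?d F w u = ?p" using uw metric_form_commute[of ?d F w u] by (simp add: dist_commute)
    have ww: "metric_form ?d F w w = ?M" by (rule metric_form_weighting[OF w(1)])
    \<comment> \<open>With multiplier \<open>C\<close> the expansion is at most
      \<open>C * (C * M - card P)\<close>, so the claim is read off from the sign.\<close>
    have "metric_form ?d F (\<lambda>x. u x - C * w x) (\<lambda>x. u x - C * w x)
        = metric_form ?d F u u - C * metric_form ?d F u w - C * metric_form ?d F w u + C * (C * metric_form ?d F w w)"
      by (simp add: metric_form_def sum_distrib_left sum_subtractf[symmetric] sum.distrib[symmetric] algebra_simps)
    also have "\<dots> \<le> ?p * C - C * ?p - C * ?p + C * (C * ?M)" unfolding uw wu ww using uu by (simp add: mult.commute)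
    finally have "0 \<le> C * (C * ?M - ?p)"
      using metric_form_nonneg[OF t F, of "\<lambda>x. u x - C * w x"] by (simp add: algebra_simps)
    then show "?p \<le> C * finite_magnitude ?d F"
      unfolding w(2) using C(1) by (simp add: zero_le_mult_iff)
  qed
qed

lemma separated_mono: "separated r S \<Longrightarrow> s \<le> r \<Longrightarrow> separated s S"
  by (fastforce simp: separated_def)

lemma compact_separated_card_bound:
  fixes X :: "'a::euclidean_space set"
  assumes "compact X"
  obtains K where "0 < K" "\<And>r S. 0 < r \<Longrightarrow> r \<le> 1 \<Longrightarrow> finite S \<Longrightarrow> S \<subseteq> X \<Longrightarrow> separated r S \<Longrightarrow>
    real (card S) \<le> K * r powr (- real DIM('a))"
proof -
  obtain R where R: "0 < R" "X \<subseteq> cball 0 R"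
    using compact_imp_bounded[OF assms] by (auto simp: bounded_pos subset_iff)
  show thesis
    by (rule that[of "(2 * (R + 1)) ^ DIM('a)"]) (use R separated_card_bound[where 'a = 'a, of _ _ R] in auto)
qed

section \<open>Packing numbers and dimensions\<close>

definition packings :: "real \<Rightarrow> 'a::metric_space set \<Rightarrow> 'a set set" where
  "packings \<delta> X = {P. finite P \<and> P \<subseteq> X \<and> disjoint_family_on (\<lambda>x. cball x \<delta> \<inter> X) P}"

lemma packing_number_eq: "packing_number \<delta> X = Sup (card ` packings \<delta> X)"
  unfolding packing_number_def packings_def by (rule arg_cong[of _ _ Sup]) auto

text \<open>Balls are cut down to \<open>X\<close>, so a point common to two full balls may lie
  outside \<open>X\<close>: disjointness yields separation by \<open>\<delta>\<close> only, while
  the converse needs \<open>2 * \<delta>\<close>. This gap explains the radius \<open>2 / t\<close>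
  in the upper bound for the magnitude.\<close>

lemma packing_separated:
  assumes "P \<in> packings \<delta> X" "0 < \<delta>" shows "separated \<delta> P"
  unfolding separated_def
proof (intro ballI impI)
  fix x y assume xy: "x \<in> P" "y \<in> P" "x \<noteq> y"
  then have "(cball x \<delta> \<inter> X) \<inter> (cball y \<delta> \<inter> X) = {}" "y \<in> X" "y \<in> cball y \<delta>"
    using assms by (auto simp: packings_def disjoint_family_on_def)
  then have "y \<notin> cball x \<delta>" by blast
  then show "\<delta> < dist x y" by simp
qed

lemma separated_packing:
  assumes "finite P" "P \<subseteq> X" "separated (2 * \<delta>) P" shows "P \<in> packings \<delta> X"
  using assms separated_disjoint[OF assms(3)]
  by (auto simp: packings_def disjoint_family_on_def)

text \<open>Compactness bounds the sizes of packings, which turns the supremum of naturals into a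
  maximum. The packing number then lies between the largest sizes of
  \<open>2 * \<delta>\<close>-separated and of \<open>\<delta>\<close>-separated sets.\<close>

lemma packing_number_attained:
  fixes X :: "'a::euclidean_space set"
  assumes "compact X" "0 < \<delta>"
  shows "\<exists>P. finite P \<and> P \<subseteq> X \<and> separated \<delta> P \<and> card P = packing_number \<delta> X"
    and "\<And>P. finite P \<Longrightarrow> P \<subseteq> X \<Longrightarrow> separated (2 * \<delta>) P \<Longrightarrow> card P \<le> packing_number \<delta> X"
proof -
  obtain K where K: "0 < K" "\<And>r S. 0 < r \<Longrightarrow> r \<le> 1 \<Longrightarrow> finite S \<Longrightarrow> S \<subseteq> X \<Longrightarrow> separated r S \<Longrightarrow>
    real (card S) \<le> K * r powr (- real DIM('a))"
    using compact_separated_card_bound[OF assms(1)] by blast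
  \<comment> \<open>The volume bound covers scales up to 1, and separation by
    \<open>\<delta>\<close> implies separation by the minimum.\<close>
  define N where "N = nat \<lfloor>K * min \<delta> 1 powr (- real DIM('a))\<rfloor>"
  have "card P \<le> N" if "P \<in> packings \<delta> X" for P
    unfolding N_def using packing_separated[OF that assms(2)] that assms(2)
    by (intro le_nat_floor K(2)) (auto simp: packings_def elim: separated_mono)
  then have "card ` packings \<delta> X \<subseteq> {..N}" by blast
  then have fin: "finite (card ` packings \<delta> X)" by (rule finite_subset) simp
  have "{} \<in> packings \<delta> X" by (simp add: packings_def disjoint_family_on_def)
  then have ne: "card ` packings \<delta> X \<noteq> {}" by blast
  have eq: "packing_number \<delta> X = Max (card ` packings \<delta> X)"
    unfolding packing_number_eq by (rule cSup_eq_Max[OF fin ne])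
  from Max_in[OF fin ne] obtain P where "P \<in> packings \<delta> X" "card P = packing_number \<delta> X"
    unfolding eq by auto
  then show "\<exists>P. finite P \<and> P \<subseteq> X \<and> separated \<delta> P \<and> card P = packing_number \<delta> X"
    using packing_separated assms(2) by (auto simp: packings_def)
  fix P assume "finite P" "P \<subseteq> X" "separated (2 * \<delta>) P"
  then have "P \<in> packings \<delta> X" by (rule separated_packing)
  then show "card P \<le> packing_number \<delta> X" unfolding eq using fin by (intro Max_ge) auto
qed

text \<open>A maximal \<open>2 / t\<close>-separated set is both a cover for the upper bound and no
  larger than the packing number; an optimal packing is \<open>1 / t\<close>-separated, as the lower
  bound requires. The constants are uniform in the finite subset and so survive the
  supremum.\<close>

lemma magnitude_packing_number:
  fixes X :: "(real ^ 'n) set"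
  assumes "compact X"
  obtains C where "0 < C"
    "\<And>t. 0 < t \<Longrightarrow> magnitude (\<lambda>x y. t * dist x y) X \<le> C * real (packing_number (1 / t) X)"
    "\<And>t. 0 < t \<Longrightarrow> real (packing_number (1 / t) X) \<le> C * magnitude (\<lambda>x y. t * dist x y) X"
proof -
  obtain C1 where C1: "0 < C1" "\<And>t F P :: (real ^ 'n) set. 0 < t \<Longrightarrow> finite F \<Longrightarrow> finite P \<Longrightarrow>
    F \<subseteq> (\<Union>p\<in>P. cball p (2 / t)) \<Longrightarrow> finite_magnitude (\<lambda>x y. t * dist x y) F \<le> C1 * real (card P)"
    using finite_magnitude_upper by blast
  obtain C2 where C2: "0 < C2" "\<And>t F P :: (real ^ 'n) set. 0 < t \<Longrightarrow> finite F \<Longrightarrow> P \<subseteq> F \<Longrightarrow>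
    separated (1 / t) P \<Longrightarrow> real (card P) \<le> C2 * finite_magnitude (\<lambda>x y. t * dist x y) F"
    using finite_magnitude_lower by blast
  have up: "finite_magnitude (\<lambda>x y. t * dist x y) F \<le> C1 * real (packing_number (1 / t) X)"
    if t: "0 < t" and F: "finite F" "F \<subseteq> X" for t F
  proof -
    note pn = packing_number_attained(2)[OF assms, of "1 / t"]
    obtain P where P: "finite P" "P \<subseteq> X" "separated (2 / t) P" "\<And>x. x \<in> X \<Longrightarrow> \<exists>p\<in>P. dist x p \<le> 2 / t"
      using maximal_separated[of "2 / t" X "packing_number (1 / t) X"] pn t by auto
    have "F \<subseteq> (\<Union>p\<in>P. cball p (2 / t))" using P(4) F(2) by (force simp: dist_commute)
    from C1(2)[OF t F(1) P(1) this]
    have "finite_magnitude (\<lambda>x y. t * dist x y) F \<le> C1 * real (card P)" .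
    also have "\<dots> \<le> C1 * real (packing_number (1 / t) X)"
      using pn[of P] P t C1(1) by (intro mult_left_mono) auto
    finally show ?thesis .
  qed
  have up': "magnitude (\<lambda>x y. t * dist x y) X \<le> C1 * real (packing_number (1 / t) X)" if t: "0 < t" for t
    using up[OF t] unfolding magnitude_def by (auto intro!: cSUP_least)
  have low: "real (packing_number (1 / t) X) \<le> C2 * magnitude (\<lambda>x y. t * dist x y) X" if t: "0 < t" for t
  proof -
    obtain P where P: "finite P" "P \<subseteq> X" "separated (1 / t) P" "card P = packing_number (1 / t) X"
      using packing_number_attained(1)[OF assms, of "1 / t"] t by auto
    show ?thesis
    proof (cases "finite X")
      case True
      then show ?thesis using C2(2)[OF t True P(2,3)] P(4) by (simp add: magnitude_def)
    next
      case False
      \<comment> \<open>The supremum is only conditionally complete; the uniform upper bound makes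
        it an actual upper bound.\<close>
      have "bdd_above (finite_magnitude (\<lambda>x y. t * dist x y) ` {F. finite F \<and> F \<subseteq> X})"
        using up[OF t] by (intro bdd_aboveI2) auto
      then have "finite_magnitude (\<lambda>x y. t * dist x y) P \<le> magnitude (\<lambda>x y. t * dist x y) X"
        unfolding magnitude_def using False P by (auto intro: cSUP_upper)
      then show ?thesis
        using C2(2)[OF t P(1) order_refl P(3)] P(4) mult_left_mono[OF _ less_imp_le[OF C2(1)]]
        by (metis order_trans)
    qed
  qed
  have mag0: "0 \<le> magnitude (\<lambda>x y. t * dist x y) X" if "0 < t" for t
  proof -
    have "0 \<le> C2 * magnitude (\<lambda>x y. t * dist x y) X"
      using low[OF that] by (rule order_trans[OF of_nat_0_le_iff])
    then show ?thesis using C2(1) by (simp add: zero_le_mult_iff)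
  qed
  show thesis
  proof (rule that[of "max C1 C2"])
    show "0 < max C1 C2" using C1(1) by simp
    fix t :: real assume t: "0 < t"
    show "magnitude (\<lambda>x y. t * dist x y) X \<le> max C1 C2 * real (packing_number (1 / t) X)"
      by (rule order_trans[OF up'[OF t]]) (intro mult_right_mono, auto)
    show "real (packing_number (1 / t) X) \<le> max C1 C2 * magnitude (\<lambda>x y. t * dist x y) X"
      by (rule order_trans[OF low[OF t]]) (intro mult_right_mono mag0 t, auto)
  qed
qed

lemma magnitude_growth_packing:
  fixes X :: "(real ^ 'n) set"
  assumes "compact X"
  shows "((\<lambda>t. magnitude_growth X t - ln (real (packing_number (1 / t) X)) / ln t) \<longlongrightarrow> 0) at_top"
proof -
  obtain C where C: "0 < C"
    "\<And>t. 0 < t \<Longrightarrow> magnitude (\<lambda>x y. t * dist x y) X \<le> C * real (packing_number (1 / t) X)"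
    "\<And>t. 0 < t \<Longrightarrow> real (packing_number (1 / t) X) \<le> C * magnitude (\<lambda>x y. t * dist x y) X"
    using magnitude_packing_number[OF assms] by blast
  have bound: "\<bar>magnitude_growth X t - ln (real (packing_number (1 / t) X)) / ln t\<bar> \<le> \<bar>ln C\<bar> / ln t" if t: "1 < t" for t
  proof -
    let ?m = "magnitude (\<lambda>x y. t * dist x y) X" and ?p = "real (packing_number (1 / t) X)"
    have t0: "0 < t" and lt: "0 < ln t" using t by simp_all
    have "\<bar>ln ?m - ln ?p\<bar> \<le> \<bar>ln C\<bar>"
    proof (cases "?p = 0")
      case True
      \<comment> \<open>Here \<open>X\<close> is empty; both quantities vanish and
        \<open>ln 0 = 0\<close>.\<close>
      then have "?m = 0" using C(2)[OF t0] C(3)[OF t0] C(1) by (simp add: zero_le_mult_iff)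
      then show ?thesis using True by simp
    next
      case False
      then have p: "0 < ?p" by linarith
      then have "0 < C * ?m" using C(3)[OF t0] by linarith
      then have m: "0 < ?m" using C(1) by (simp add: zero_less_mult_iff)
      have "ln ?m \<le> ln (C * ?p)" "ln ?p \<le> ln (C * ?m)"
        using C(2,3)[OF t0] m p by (auto intro!: ln_mono simp del: of_nat_0_less_iff)
      moreover have "ln (C * ?p) = ln C + ln ?p" "ln (C * ?m) = ln C + ln ?m"
        using C(1) m p by (simp_all add: ln_mult)
      ultimately show ?thesis by linarith
    qed
    then show ?thesis
      using lt by (simp add: magnitude_growth_def diff_divide_distrib[symmetric] abs_div_pos[symmetric] divide_right_mono)
  qed
  show ?thesis
  proof (rule Lim_null_comparison)
    show "\<forall>\<^sub>F t in at_top. norm (magnitude_growth X t - ln (real (packing_number (1 / t) X)) / ln t) \<le> \<bar>ln C\<bar> / ln t"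
      using eventually_gt_at_top[of 1] by eventually_elim (simp only: real_norm_def bound)
    show "((\<lambda>t. \<bar>ln C\<bar> / ln t) \<longlongrightarrow> 0) at_top" by real_asymp
  qed
qed

section \<open>Persistent homology dimension and upper Minkowski dimension\<close>

lemma minkowski_dimension_le:
  fixes X :: "'a::euclidean_space set"
  assumes "0 < C" "0 \<le> \<alpha>" and le: "\<And>\<delta>. 0 < \<delta> \<Longrightarrow> \<delta> < 1 \<Longrightarrow> real (packing_number \<delta> X) \<le> C * \<delta> powr (- \<alpha>)"
  shows "minkowski_dimension X \<le> ereal \<alpha>"
proof -
  have bound: "packing_growth X \<delta> \<le> ereal (\<alpha> + \<bar>ln C\<bar> / ln (1 / \<delta>))" if \<delta>: "0 < \<delta>" "\<delta> < 1" for \<delta>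
  proof -
    let ?p = "real (packing_number \<delta> X)"
    have l: "0 < ln (1 / \<delta>)" using \<delta> by simp
    have "ln ?p \<le> \<bar>ln C\<bar> + \<alpha> * ln (1 / \<delta>)"
    proof (cases "?p = 0")
      case True
      then show ?thesis using l assms by simp
    next
      case False
      then have "ln ?p \<le> ln (C * \<delta> powr (- \<alpha>))" using le[OF \<delta>] by (intro ln_mono) auto
      also have "\<dots> = ln C + \<alpha> * ln (1 / \<delta>)" using assms \<delta> by (simp add: ln_mult ln_powr ln_div)
      finally show ?thesis by linarith
    qed
    then have "ln ?p / ln (1 / \<delta>) \<le> (\<bar>ln C\<bar> + \<alpha> * ln (1 / \<delta>)) / ln (1 / \<delta>)"
      using l by (intro divide_right_mono) auto
    then show ?thesis using l by (simp add: packing_growth_def add_divide_distrib add.commute)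
  qed
  have "minkowski_dimension X \<le> Limsup (at_right 0) (\<lambda>\<delta>. ereal (\<alpha> + \<bar>ln C\<bar> / ln (1 / \<delta>)))"
    unfolding minkowski_dimension_def
    by (intro Limsup_mono eventually_mono[OF eventually_at_right_real[of 0 1]]) (auto intro: bound)
  also have "\<dots> = ereal \<alpha>"
  proof (rule lim_imp_Limsup)
    have "((\<lambda>\<delta>. \<alpha> + \<bar>ln C\<bar> / ln (1 / \<delta>)) \<longlongrightarrow> \<alpha>) (at_right 0)" by real_asymp
    then show "((\<lambda>\<delta>. ereal (\<alpha> + \<bar>ln C\<bar> / ln (1 / \<delta>))) \<longlongrightarrow> ereal \<alpha>) (at_right 0)" by simp
  qed simp
  finally show ?thesis .
qed

text \<open>\<open>ph0_dimension\<close> admits positive exponents only; this ensures that every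
  real number above the Minkowski dimension is one.\<close>

lemma minkowski_dimension_nonneg: "0 \<le> minkowski_dimension X"
proof -
  have "0 \<le> packing_growth X \<delta>" if "\<delta> \<in> {0<..<1}" for \<delta>
  proof -
    have "0 \<le> ln (real (packing_number \<delta> X))" by (cases "packing_number \<delta> X") auto
    moreover have "0 \<le> ln (1 / \<delta>)" using that by simp
    ultimately show ?thesis by (simp add: packing_growth_def)
  qed
  then have "0 \<le> Liminf (at_right 0) (packing_growth X)"
    by (intro Liminf_bounded eventually_mono[OF eventually_at_right_real[of 0 1]]) auto
  also have "\<dots> \<le> minkowski_dimension X"
    unfolding minkowski_dimension_def by (rule Liminf_le_Limsup) simp
  finally show ?thesis .
qed

lemma minkowski_dimension_finite:
  fixes X :: "'a::euclidean_space set"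
  assumes "compact X" shows "minkowski_dimension X \<le> ereal (real DIM('a))"
proof -
  obtain K where K: "0 < K" "\<And>r S. 0 < r \<Longrightarrow> r \<le> 1 \<Longrightarrow> finite S \<Longrightarrow> S \<subseteq> X \<Longrightarrow> separated r S \<Longrightarrow>
    real (card S) \<le> K * r powr (- real DIM('a))"
    using compact_separated_card_bound[OF assms(1)] by blast
  show ?thesis
  proof (rule minkowski_dimension_le[OF K(1)])
    fix \<delta> :: real assume \<delta>: "0 < \<delta>" "\<delta> < 1"
    obtain P where "finite P" "P \<subseteq> X" "separated \<delta> P" "card P = packing_number \<delta> X"
      using packing_number_attained(1)[OF assms \<delta>(1)] by blast
    then show "real (packing_number \<delta> X) \<le> K * \<delta> powr (- real DIM('a))"
      using K(2)[of \<delta> P] \<delta> by simp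
  qed simp
qed

text \<open>An exponent \<open>\<beta>\<close> strictly between the dimension and
  \<open>\<alpha>\<close> controls packing numbers at small scales, and the dyadic estimate turns
  the gap \<open>\<alpha> - \<beta>\<close> into convergence.\<close>

lemma lifetime_sum_bounded:
  fixes X :: "'a::euclidean_space set"
  assumes "compact X" "0 < \<alpha>" "minkowski_dimension X < ereal \<alpha>"
  shows "\<exists>C>0. \<forall>W. finite W \<and> W \<subseteq> X \<longrightarrow> lifetime_sum \<alpha> W < C"
proof -
  obtain \<gamma> where \<gamma>: "minkowski_dimension X < ereal \<gamma>" "ereal \<gamma> < ereal \<alpha>"
    using ereal_dense2[OF assms(3)] by blast
  \<comment> \<open>Nonnegativity makes \<open>r powr (- \<beta>)\<close> decreasing in
    \<open>r\<close>, which is needed for the large scales.\<close>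
  define \<beta> where "\<beta> = max \<gamma> 0"
  have \<beta>: "0 \<le> \<beta>" "\<beta> < \<alpha>" "minkowski_dimension X < ereal \<beta>"
    using \<gamma> assms(2) less_le_trans[OF \<gamma>(1), of "ereal \<beta>"] by (auto simp: \<beta>_def)
  have "eventually (\<lambda>\<delta>. packing_growth X \<delta> < ereal \<beta>) (at_right 0)"
    using \<beta>(3) unfolding minkowski_dimension_def by (rule Limsup_lessD)
  then obtain e where e: "0 < e" "\<And>\<delta>. 0 < \<delta> \<Longrightarrow> \<delta> < e \<Longrightarrow> packing_growth X \<delta> < ereal \<beta>"
    unfolding eventually_at_right_field by auto
  define \<delta>0 where "\<delta>0 = min e 1 / 2"
  have \<delta>0: "0 < \<delta>0" "\<delta>0 < e" "\<delta>0 < 1" using e(1) by (auto simp: \<delta>0_def)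
  have small: "real (packing_number \<delta> X) \<le> \<delta> powr (- \<beta>)" if \<delta>: "0 < \<delta>" "\<delta> \<le> \<delta>0" for \<delta>
  proof (cases "packing_number \<delta> X = 0")
    case False
    have l: "0 < ln (1 / \<delta>)" using \<delta> \<delta>0 by simp
    have "ln (real (packing_number \<delta> X)) / ln (1 / \<delta>) < \<beta>"
      using e(2)[of \<delta>] \<delta> \<delta>0 by (simp add: packing_growth_def)
    then have "ln (real (packing_number \<delta> X)) \<le> \<beta> * ln (1 / \<delta>)"
      using l by (simp add: divide_less_eq)
    also have "\<dots> = ln (\<delta> powr (- \<beta>))" using \<delta> by (simp add: ln_powr ln_div)
    finally show ?thesis using False \<delta> by (subst (asm) ln_le_cancel_iff) auto
  qed simp
  obtain R where R: "0 < R" "\<And>x y. x \<in> X \<Longrightarrow> y \<in> X \<Longrightarrow> dist x y \<le> R"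
  proof -
    obtain R where "\<forall>x\<in>X. \<forall>y\<in>X. dist x y \<le> R"
      using compact_imp_bounded[OF assms(1)] by (auto simp: bounded_two_points)
    then show thesis by (intro that[of "max R 1"]) (auto simp: max.coboundedI1)
  qed
  \<comment> \<open>The first summand pays for passing from separation \<open>r\<close> to packings
    at \<open>r / 2\<close>; the second covers scales from \<open>2 * \<delta>0\<close> up to the
    diameter bound \<open>R\<close>, where the packing number at \<open>\<delta>0\<close>
    suffices.\<close>
  define C where "C = 2 powr \<beta> + real (packing_number \<delta>0 X) * R powr \<beta>"
  have C: "0 \<le> C" by (simp add: C_def)
  have sep: "real (card S) \<le> C * r powr (- \<beta>)"
    if r: "0 < r" "r \<le> R" and S: "finite S" "S \<subseteq> X" "separated r S" for r S
  proof (cases "r / 2 \<le> \<delta>0")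
    case True
    have "real (card S) \<le> real (packing_number (r / 2) X)"
      using packing_number_attained(2)[OF assms(1), of "r / 2" S] r S by simp
    also have "\<dots> \<le> (r / 2) powr (- \<beta>)" using True r by (intro small) auto
    also have "\<dots> = 2 powr \<beta> * r powr (- \<beta>)" 
    proof -
      have "(r / 2) powr (- \<beta>) = r powr (- \<beta>) / 2 powr (- \<beta>)" by (rule powr_divide)
      then show ?thesis by (simp only: powr_minus divide_inverse inverse_inverse_eq mult.commute)
    qed
    also have "\<dots> \<le> C * r powr (- \<beta>)" by (intro mult_right_mono) (auto simp: C_def)
    finally show ?thesis .
  next
    case False
    have "real (card S) \<le> real (packing_number \<delta>0 X)"
      using packing_number_attained(2)[OF assms(1) \<delta>0(1), of S] False S separated_mono[OF S(3), of "2 * \<delta>0"] by simp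
    also have "\<dots> = real (packing_number \<delta>0 X) * R powr \<beta> * R powr (- \<beta>)"
      using R(1) by (simp add: powr_minus)
    also have "\<dots> \<le> real (packing_number \<delta>0 X) * R powr \<beta> * r powr (- \<beta>)"
      using r \<beta>(1) by (intro mult_left_mono powr_mono2') auto
    also have "\<dots> \<le> C * r powr (- \<beta>)" by (intro mult_right_mono) (auto simp: C_def)
    finally show ?thesis .
  qed
  define B where "B = C * 2 powr \<beta> * R powr (\<alpha> - \<beta>) / (1 - 2 powr (\<beta> - \<alpha>))"
  have "lifetime_sum \<alpha> W \<le> B" if W: "finite W" "W \<subseteq> X" for W
    unfolding B_def
  proof (rule lifetime_sum_le[OF W(1) R(1) C \<beta>(2) assms(2)])
    fix x y assume "x \<in> W" "y \<in> W"
    then show "dist x y \<le> R" using W(2) R(2) by blast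
  next
    fix r S assume "0 < r" "r \<le> R" "S \<subseteq> W" "separated r S"
    then show "real (card S) \<le> C * r powr (- \<beta>)"
      using W finite_subset[of S W] by (intro sep) auto
  qed
  then show ?thesis by (intro exI[of _ "\<bar>B\<bar> + 1"]) fastforce
qed

text \<open>An optimal packing at scale \<open>\<delta>\<close> is itself a test set
  \<open>W\<close>, and its bars are longer than \<open>\<delta>\<close>.\<close>

lemma minkowski_dimension_le_if_bounded:
  fixes X :: "'a::euclidean_space set"
  assumes "compact X" "0 < \<alpha>" "0 < C" and bound: "\<And>W. finite W \<Longrightarrow> W \<subseteq> X \<Longrightarrow> lifetime_sum \<alpha> W < C"
  shows "minkowski_dimension X \<le> ereal \<alpha>"
proof (rule minkowski_dimension_le)
  fix \<delta> :: real assume \<delta>: "0 < \<delta>" "\<delta> < 1"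
  obtain P where P: "finite P" "P \<subseteq> X" "separated \<delta> P" "card P = packing_number \<delta> X"
    using packing_number_attained(1)[OF assms(1) \<delta>(1)] by blast
  let ?p = "real (packing_number \<delta> X)"
  have "(?p - 1) * \<delta> powr \<alpha> \<le> C"
    using lifetime_sum_separated[OF P(1,3) \<delta>(1) assms(2)] bound[OF P(1,2)] P(4) by simp
  then have "?p - 1 \<le> C * \<delta> powr (- \<alpha>)"
    using \<delta> by (simp add: powr_minus divide_inverse[symmetric] le_divide_eq)
  \<comment> \<open>Absorbs the point lost to the component that never dies.\<close>
  moreover have "1 \<le> \<delta> powr (- \<alpha>)" using \<delta> assms(2) by (simp add: powr_minus one_le_inverse powr_le1)
  ultimately show "?p \<le> (1 + C) * \<delta> powr (- \<alpha>)" by (simp add: distrib_right)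
qed (use assms in auto)

lemma ph0_dimension_eq_minkowski:
  fixes X :: "'a::euclidean_space set"
  assumes "compact X" shows "ph0_dimension X = minkowski_dimension X"
proof (rule antisym)
  show "minkowski_dimension X \<le> ph0_dimension X"
    unfolding ph0_dimension_def
    by (intro Inf_greatest) (auto intro: minkowski_dimension_le_if_bounded[OF assms])
  show "ph0_dimension X \<le> minkowski_dimension X"
  proof (rule ccontr)
    assume "\<not> ?thesis"
    then obtain \<alpha> where \<alpha>: "minkowski_dimension X < ereal \<alpha>" "ereal \<alpha> < ph0_dimension X"
      using ereal_dense2 by (metis not_le)
    have "0 < ereal \<alpha>" using minkowski_dimension_nonneg \<alpha>(1) by (rule le_less_trans)
    then have "0 < \<alpha>" by simp
    with lifetime_sum_bounded[OF assms this \<alpha>(1)] have "ph0_dimension X \<le> ereal \<alpha>"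
      unfolding ph0_dimension_def by (intro Inf_lower) auto
    with \<alpha>(2) show False by simp
  qed
qed

theorem theorem4p1:
  fixes X :: "(real ^ 'n) set"
  assumes "compact X"
    and "magnitude_dimension_exists X \<or> minkowski_dimension_exists X"
  shows "magnitude_dimension_exists X \<and> ereal (magnitude_dimension X) = ph0_dimension X"
proof -
  define g where "g t = ln (real (packing_number (1 / t) X)) / ln t" for t
  have diff: "((\<lambda>t. magnitude_growth X t - g t) \<longlongrightarrow> 0) at_top"
    unfolding g_def by (rule magnitude_growth_packing[OF assms(1)])
  have g: "packing_growth X (inverse t) = ereal (g t)" for t
    by (simp add: packing_growth_def g_def divide_inverse)
  have "\<exists>s. (magnitude_growth X \<longlongrightarrow> s) at_top \<and> minkowski_dimension X = ereal s"
    using assms(2)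
  proof
    assume "magnitude_dimension_exists X"
    then obtain s where s: "(magnitude_growth X \<longlongrightarrow> s) at_top"
      by (auto simp: magnitude_dimension_exists_def)
    \<comment> \<open>Convergence passes to the packing growth along \<open>1 / t\<close>, so the
      upper limit defining the Minkowski dimension is a true limit.\<close>
    from tendsto_diff[OF s diff] have "(g \<longlongrightarrow> s) at_top" by simp
    then have "((\<lambda>t. packing_growth X (inverse t)) \<longlongrightarrow> ereal s) at_top" by (simp add: g)
    then have "(packing_growth X \<longlongrightarrow> ereal s) (at_right 0)"
      by (simp add: at_right_to_top filterlim_filtermap)
    then have "minkowski_dimension X = ereal s"
      unfolding minkowski_dimension_def by (intro lim_imp_Limsup) auto
    with s show ?thesis by blast
  next
    assume ex: "minkowski_dimension_exists X"
    \<comment> \<open>The Minkowski dimension is an extended real; it must be finite for its limit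
      to be transferred to the real-valued magnitude growth.\<close>
    obtain s where s: "minkowski_dimension X = ereal s"
      using minkowski_dimension_nonneg[of X] minkowski_dimension_finite[OF assms(1)]
      by (cases "minkowski_dimension X") auto
    have "(packing_growth X \<longlongrightarrow> ereal s) (at_right 0)"
      using ex by (simp add: minkowski_dimension_exists_def s)
    then have "((\<lambda>t. packing_growth X (inverse t)) \<longlongrightarrow> ereal s) at_top"
      by (simp add: at_right_to_top filterlim_filtermap)
    then have "(g \<longlongrightarrow> s) at_top" by (simp add: g)
    from tendsto_add[OF diff this] have "(magnitude_growth X \<longlongrightarrow> s) at_top" by simp
    with s show ?thesis by blast
  qed
  then obtain s where s: "(magnitude_growth X \<longlongrightarrow> s) at_top" "minkowski_dimension X = ereal s" by blast
  then have "magnitude_dimension X = s"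
    unfolding magnitude_dimension_def by (intro tendsto_Lim) auto
  then show ?thesis
    using s ph0_dimension_eq_minkowski[OF assms(1)] by (auto simp: magnitude_dimension_exists_def)
qed

end
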